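(* Let $\mathfrak{X}$ be an association scheme of rank $4$ and diameter $2$ on $n\ge29$ vertices, with constituents ordered by degree, and suppose $k_2\le \varepsilon k_3/2$ for some $\varepsilon<10^{-11}$. Suppose that $k_2\le\frac{101}{100}k_1$ and that $X_2$ is strongly regular with smallest eigenvalue $-2$. Then $$q(X_{1,2})+\xi(X_{1,2})\le \frac{99}{100}(k_1+k_2).$$
   Context: An association scheme of rank $r$ on a finite vertex set $V$ ($|V|=n$) is a surjective map $c:V\times V\to\{0,1,\dots,r-1\}$ such that $c(u,v)=0$ iff $u=v$, $c(u,v)=c(v,u)$, and for all colors $i,j,t$ there is an integer $p^t_{i,j}$ such that whenever $c(u,v)=t$ there are exactly $p^t_{i,j}$ vertices $w$ with $c(u,w)=i$, $c(w,v)=j$. The constituent $X_i$ is the graph on $V$ with distinct $u,v$ adjacent iff $c(u,v)=i$; it is regular of degree $k_i=p^0_{i,i}$. $X_{1,2}$ is the graph on $V$ with $u,v$ adjacent iff $c(u,v)\in\{1,2\}$ (regular of degree $k_1+k_2$). The scheme has diameter $2$ if every $X_i$ ($i\ne0$) has diameter at most $2$ and some has diameter exactly $2$. Constituents are ordered by degree if $k_1\le k_2\le k_3$. For a graph $X$, $q(X)$ is the maximum number of common neighbours of two distinct vertices. For a $k$-regular graph with adjacency eigenvalues $k=\xi_1\ge\dots\ge\xi_n$, the zero-weight spectral radius is $\xi(X)=\max\{|\xi_i|:2\le i\le n\}$. *)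

theory Defs
  imports
    "Graph_Theory.Graph_Theory"
    "Jordan_Normal_Form.Spectral_Radius"
    "HOL-Library.Countable_Set"
begin

section \<open>Finite graphs\<close>

text \<open>Undirected graphs are symmetric loop-free digraphs, as in \<^theory>\<open>Graph_Theory.Digraph\<close>.
  In such a graph the out-degree of a vertex is its degree.\<close>

definition graph_diameter :: "('a, 'b) pre_digraph \<Rightarrow> ereal" where
  "graph_diameter G = (SUP (u, v) \<in> verts G \<times> verts G. wf_digraph.\<mu> G (\<lambda>_. 1) u v)"

definition common_neighbours :: "('a, 'b) pre_digraph \<Rightarrow> 'a \<Rightarrow> 'a \<Rightarrow> 'a set" where
  "common_neighbours G u v = {w \<in> verts G. u \<rightarrow>\<^bsub>G\<^esub> w \<and> v \<rightarrow>\<^bsub>G\<^esub> w}"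

definition max_common_neighbours :: "('a, 'b) pre_digraph \<Rightarrow> nat" where
  "max_common_neighbours G =
     Max {card (common_neighbours G u v) | u v. u \<in> verts G \<and> v \<in> verts G \<and> u \<noteq> v}"

text \<open>Complete and empty graphs are not excluded here. A constituent of an association scheme of
  rank at least 3 is neither, so the convention makes no difference for it.\<close>

definition strongly_regular :: "('a, 'b) pre_digraph \<Rightarrow> bool" where
  "strongly_regular G \<longleftrightarrow> (\<exists>k l m.
     (\<forall>u \<in> verts G. out_degree G u = k) \<and>
     (\<forall>u \<in> verts G. \<forall>v \<in> verts G. u \<noteq> v \<longrightarrow>
        card (common_neighbours G u v) = (if u \<rightarrow>\<^bsub>G\<^esub> v then l else m)))"

text \<open>For finite \<^term>\<open>V\<close>, \<^term>\<open>from_nat_into V\<close> enumerates \<^term>\<open>V\<close> bijectively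
  by \<^term>\<open>{..<card V}\<close>; the spectrum does not depend on the enumeration.\<close>

definition adjacency_matrix :: "('a, 'b) pre_digraph \<Rightarrow> real mat" where
  "adjacency_matrix G = mat (card (verts G)) (card (verts G))
     (\<lambda>(i, j). if from_nat_into (verts G) i \<rightarrow>\<^bsub>G\<^esub> from_nat_into (verts G) j then 1 else 0)"

text \<open>The eigenvalues with multiplicity, in descending order. For an undirected graph the matrix is
  real symmetric, so all roots of its characteristic polynomial are real and the list has length
  \<^term>\<open>card (verts G)\<close>.\<close>

definition adjacency_eigenvalues :: "('a, 'b) pre_digraph \<Rightarrow> real list" where
  "adjacency_eigenvalues G =
     rev (sorted_list_of_multiset (proots (char_poly (adjacency_matrix G))))"

definition smallest_eigenvalue :: "('a, 'b) pre_digraph \<Rightarrow> real" where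
  "smallest_eigenvalue G = Min (spectrum (adjacency_matrix G))"

text \<open>For a regular graph the discarded head of the list is the degree. Only one copy is discarded:
  if the degree is a multiple eigenvalue, the radius equals the degree.\<close>

definition zero_weight_spectral_radius :: "('a, 'b) pre_digraph \<Rightarrow> real" where
  "zero_weight_spectral_radius G = Max (abs ` set (tl (adjacency_eigenvalues G)))"

section \<open>Association schemes\<close>

locale association_scheme =
  fixes V :: "'a set" and c :: "'a \<Rightarrow> 'a \<Rightarrow> nat" and r :: nat
  assumes finite_vertices: "finite V"
    and surj_colors: "case_prod c ` (V \<times> V) = {0..<r}"
    and diagonal: "\<lbrakk>u \<in> V; v \<in> V\<rbrakk> \<Longrightarrow> c u v = 0 \<longleftrightarrow> u = v"
    and symmetric_colors: "\<lbrakk>u \<in> V; v \<in> V\<rbrakk> \<Longrightarrow> c u v = c v u"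
    and regularity: "\<lbrakk>i < r; j < r; t < r\<rbrakk> \<Longrightarrow>
      \<exists>p. \<forall>u \<in> V. \<forall>v \<in> V. c u v = t \<longrightarrow> card {w \<in> V. c u w = i \<and> c w v = j} = p"

definition intersection_number ::
    "'a set \<Rightarrow> ('a \<Rightarrow> 'a \<Rightarrow> nat) \<Rightarrow> nat \<Rightarrow> nat \<Rightarrow> nat \<Rightarrow> nat" where
  "intersection_number V c t i j =
     (THE p. \<forall>u \<in> V. \<forall>v \<in> V. c u v = t \<longrightarrow> card {w \<in> V. c u w = i \<and> c w v = j} = p)"

definition constituent_degree :: "'a set \<Rightarrow> ('a \<Rightarrow> 'a \<Rightarrow> nat) \<Rightarrow> nat \<Rightarrow> nat" where
  "constituent_degree V c i = intersection_number V c 0 i i"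

definition color_graph :: "'a set \<Rightarrow> ('a \<Rightarrow> 'a \<Rightarrow> nat) \<Rightarrow> nat set \<Rightarrow> 'a pair_pre_digraph" where
  "color_graph V c I =
     \<lparr>pverts = V, parcs = {(u, v). u \<in> V \<and> v \<in> V \<and> u \<noteq> v \<and> c u v \<in> I}\<rparr>"

lemma (in association_scheme) pair_graph_color_graph: "pair_graph (color_graph V c I)"
proof
  show "finite (parcs (color_graph V c I))"
    by (rule finite_subset[of _ "V \<times> V"]) (auto simp: color_graph_def finite_vertices)
  show "symmetric (with_proj (color_graph V c I))"
    by (auto simp: symmetric_def sym_def color_graph_def symmetric_colors)
qed (auto simp: color_graph_def finite_vertices)

abbreviation constituent :: "'a set \<Rightarrow> ('a \<Rightarrow> 'a \<Rightarrow> nat) \<Rightarrow> nat \<Rightarrow> 'a pair_pre_digraph" where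
  "constituent V c i \<equiv> color_graph V c {i}"

definition scheme_diameter_2 :: "'a set \<Rightarrow> ('a \<Rightarrow> 'a \<Rightarrow> nat) \<Rightarrow> nat \<Rightarrow> bool" where
  "scheme_diameter_2 V c r \<longleftrightarrow>
     (\<forall>i \<in> {1..<r}. graph_diameter (constituent V c i) \<le> 2) \<and>
     (\<exists>i \<in> {1..<r}. graph_diameter (constituent V c i) = 2)"

end

theory Submission
  imports Defs
begin

text \<open>
  Write \<open>p\<^sup>t\<^sub>i\<^sub>j\<close> for the intersection numbers. Strong regularity with smallest eigenvalue \<open>-2\<close>
  gives \<open>p\<^sup>1\<^sub>2\<^sub>2 = p\<^sup>3\<^sub>2\<^sub>2 = \<mu>\<close> and \<open>4 = k\<^sub>2 - 2 p\<^sup>2\<^sub>2\<^sub>2 + \<mu>\<close>, and the second nontrivial eigenvalue of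
  \<open>X\<^sub>2\<close> is \<open>\<theta> = (k\<^sub>2 - \<mu>) / 2\<close>. Since \<open>k\<^sub>3\<close> dwarfs \<open>k\<^sub>2\<close>, all \<open>p\<^sup>3\<^sub>i\<^sub>j\<close> with \<open>i, j \<in> {1, 2}\<close> are tiny
  compared to \<open>k\<^sub>2\<close>, so \<open>p\<^sup>2\<^sub>2\<^sub>2\<close> and \<open>\<theta>\<close> are about \<open>k\<^sub>2 / 2\<close>; no classification of such
  graphs is needed. The crucial point is that \<open>p\<^sup>1\<^sub>1\<^sub>2\<close> is tiny too: otherwise \<open>X\<^sub>1\<close> would have a
  rational eigenvalue strictly between 0 and 1. Two vertices in relation 3 with a common
  \<open>X\<^sub>1\<close>-neighbour show that \<open>p\<^sup>1\<^sub>1\<^sub>1\<close> is at most about \<open>k\<^sub>1 / 2\<close>. Hence \<open>q(X\<^sub>1\<^sub>,\<^sub>2)\<close> is at most about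
  \<open>k\<^sub>2 / 2\<close>, and so are all nontrivial eigenvalues of \<open>X\<^sub>1\<^sub>,\<^sub>2\<close> in absolute value, by the quadratic
  relations between the joint eigenvalues of \<open>X\<^sub>1\<close> and \<open>X\<^sub>2\<close>.
\<close>

section \<open>Splitting off the eigenvalue of the constant vector\<close>

text \<open>In a basis starting with the all-ones vector \<open>M\<close> becomes block triangular
  with corner \<open>K\<close>, so \<open>q\<close> is the characteristic polynomial of
  \<open>M\<close> acting modulo constants. An eigenvector modulo constants, shifted to sum zero, is
  a true eigenvector because the column sums equal \<open>K\<close> as well.\<close>

lemma char_poly_deflate_constant_line_sums:
  fixes M :: "real mat"
  assumes M: "M \<in> carrier_mat (Suc m) (Suc m)"
    and row: "\<And>i. i < Suc m \<Longrightarrow> (\<Sum>j = 0..<Suc m. M $$ (i, j)) = K"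
    and col: "\<And>j. j < Suc m \<Longrightarrow> (\<Sum>i = 0..<Suc m. M $$ (i, j)) = K"
  obtains q where "char_poly M = [:- K, 1:] * q"
    and "\<And>x. poly q x = 0 \<Longrightarrow> \<exists>v \<in> carrier_vec (Suc m).
           v \<noteq> 0\<^sub>v (Suc m) \<and> (\<Sum>i = 0..<Suc m. v $ i) = 0 \<and> M *\<^sub>v v = x \<cdot>\<^sub>v v"
proof -
  define n where "n = Suc m"
  \<comment> \<open>The matrix induced on the quotient by the constant vectors, each class being
    represented by its member with coordinate \<open>0\<close> equal to zero.\<close>
  define B where "B = mat m m (\<lambda>(i, j). M $$ (Suc i, Suc j) - M $$ (0, Suc j))"
  define T where "T = four_block_mat (mat 1 1 (\<lambda>_. K)) (mat 1 m (\<lambda>(i, j). M $$ (0, Suc j))) (0\<^sub>m m 1) B"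
  \<comment> \<open>The first column of \<open>P\<close> is the all-ones vector, the others are unit
    vectors; \<open>Q\<close> is the inverse.\<close>
  define P where "P = mat n n (\<lambda>(i, j). if j = 0 \<or> i = j then 1 else (0 :: real))"
  define Q where "Q = mat n n (\<lambda>(i, j). if i = j then 1 else if j = 0 then - 1 else (0 :: real))"
  have Bc: "B \<in> carrier_mat m m" by (simp add: B_def)
  have Pc: "P \<in> carrier_mat n n" and Qc: "Q \<in> carrier_mat n n" by (simp_all add: P_def Q_def)
  have Tc: "T \<in> carrier_mat n n" unfolding T_def n_def using Bc by auto
  have Tent: "T $$ (i, j) = (if j = 0 then (if i = 0 then K else 0)
      else if i = 0 then M $$ (0, j) else M $$ (i, j) - M $$ (0, j))"
    if "i < n" "j < n" for i j
    using that Bc by (auto simp: T_def B_def n_def)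
  have PQ: "P * Q = 1\<^sub>m n"
  proof (rule eq_matI)
    fix i j assume "i < dim_row (1\<^sub>m n :: real mat)" "j < dim_col (1\<^sub>m n :: real mat)"
    hence ij: "i < Suc m" "j < Suc m" by (auto simp: n_def)
    thus "(P * Q) $$ (i, j) = 1\<^sub>m n $$ (i, j)"
      by (cases i; cases j)
        (auto simp: P_def Q_def n_def scalar_prod_def sum.atLeast0_lessThan_Suc_shift
          if_distrib[of "\<lambda>x. x * _"] cong: if_cong simp del: sum.op_ivl_Suc)
  qed (auto simp: P_def Q_def)
  have QP: "Q * P = 1\<^sub>m n"
    using mat_mult_left_right_inverse[OF Pc Qc PQ] .
  have MP: "M * P = P * T"
  proof (rule eq_matI)
    fix i j assume "i < dim_row (P * T)" "j < dim_col (P * T)"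
    hence ij: "i < Suc m" "j < Suc m" using Tc by (auto simp: P_def n_def)
    have "(M * P) $$ (i, j) = (\<Sum>l = 0..<Suc m. M $$ (i, l) * P $$ (l, j))"
      using ij M by (simp add: scalar_prod_def P_def n_def)
    also have "\<dots> = (if j = 0 then K else M $$ (i, j))"
    proof (cases "j = 0")
      case True
      have "(\<Sum>l = 0..<Suc m. M $$ (i, l) * P $$ (l, j)) = (\<Sum>l = 0..<Suc m. M $$ (i, l))"
        by (rule sum.cong) (auto simp: P_def n_def True)
      with True row[OF ij(1)] show ?thesis by simp
    next
      case False
      have "(\<Sum>l = 0..<Suc m. M $$ (i, l) * P $$ (l, j)) =
          (\<Sum>l = 0..<Suc m. if l = j then M $$ (i, l) else 0)"
        by (rule sum.cong) (use ij False in \<open>auto simp: P_def n_def\<close>)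
      with False ij(2) show ?thesis by (simp del: sum.op_ivl_Suc)
    qed
    also have "\<dots> = T $$ (0, j) + (if i = 0 then 0 else T $$ (i, j))"
      using ij by (auto simp: Tent n_def)
    also have "\<dots> = (\<Sum>l = 0..<Suc m. P $$ (i, l) * T $$ (l, j))"
      using ij by (cases i) (auto simp: P_def n_def sum.atLeast0_lessThan_Suc_shift
          if_distrib[of "\<lambda>x. x * _"] cong: if_cong simp del: sum.op_ivl_Suc)
    also have "\<dots> = (P * T) $$ (i, j)"
      using ij Tc by (simp add: scalar_prod_def P_def n_def)
    finally show "(M * P) $$ (i, j) = (P * T) $$ (i, j)" .
  qed (use M Tc in \<open>auto simp: P_def n_def\<close>)
  have Mc: "M \<in> carrier_mat n n" using M by (simp add: n_def)
  have "M = M * (P * Q)" using Mc by (simp add: PQ)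
  also have "\<dots> = P * T * Q" using Mc Pc Qc by (simp flip: MP)
  finally have "similar_mat M T"
    using similar_matI[of M T P Q n] Mc Tc Pc Qc PQ QP by auto
  hence "char_poly M = char_poly T" by (rule char_poly_similar)
  also have "\<dots> = char_poly (mat 1 1 (\<lambda>_. K)) * char_poly B"
    unfolding T_def by (rule char_poly_four_block_zeros_col) (use Bc in auto)
  also have "char_poly (mat 1 1 (\<lambda>_. K)) = [:- K, 1:]"
    by (simp add: char_poly_defs det_def sign_def)
  finally have fact: "char_poly M = [:- K, 1:] * char_poly B" .
  have "\<exists>v \<in> carrier_vec (Suc m).
      v \<noteq> 0\<^sub>v (Suc m) \<and> (\<Sum>i = 0..<Suc m. v $ i) = 0 \<and> M *\<^sub>v v = x \<cdot>\<^sub>v v"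
    if "poly (char_poly B) x = 0" for x
  proof -
    from that eigenvalue_root_char_poly[OF Bc] obtain y where "eigenvector B y x"
      unfolding eigenvalue_def by auto
    hence y: "y \<in> carrier_vec m" "y \<noteq> 0\<^sub>v m" and By: "B *\<^sub>v y = x \<cdot>\<^sub>v y"
      using Bc by (auto simp: eigenvector_def)
    \<comment> \<open>\<open>z\<close> represents the class \<open>y\<close>. Subtracting the mean
      gives the zero-sum representative \<open>v\<close>, and \<open>d\<close> is the constant by
      which each coordinate of \<open>M *\<^sub>v v\<close> still differs from that of
      \<open>x \<cdot>\<^sub>v v\<close>.\<close>
    define z where "z i = (if i = 0 then 0 else y $ (i - 1))" for i
    define mean where "mean = (\<Sum>i = 0..<n. z i) / n"
    define v where "v = vec n (\<lambda>i. z i - mean)"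
    define d where "d = (\<Sum>j = 0..<n. M $$ (0, j) * z j) - K * mean + x * mean"
    have sumv: "(\<Sum>i = 0..<n. v $ i) = 0"
      by (simp add: v_def mean_def sum_subtractf n_def del: sum.op_ivl_Suc)
    have Mz: "(\<Sum>j = 0..<n. M $$ (i, j) * z j) = x * z i + (\<Sum>j = 0..<n. M $$ (0, j) * z j)"
      if "i < n" for i
    proof (cases i)
      case 0
      thus ?thesis by (simp add: z_def)
    next
      case (Suc i')
      with that have i': "i' < m" by (simp add: n_def)
      have "(B *\<^sub>v y) $ i' = x * y $ i'" using y i' by (simp add: By)
      hence "(\<Sum>j = 0..<m. (M $$ (i, Suc j) - M $$ (0, Suc j)) * y $ j) = x * y $ i'"
        using y(1) i' by (simp add: B_def scalar_prod_def Suc)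
      thus ?thesis
        by (simp add: n_def sum.atLeast0_lessThan_Suc_shift z_def Suc left_diff_distrib sum_subtractf
            del: sum.op_ivl_Suc)
    qed
    have Mv: "(\<Sum>j = 0..<n. M $$ (i, j) * v $ j) = x * v $ i + d" if i: "i < n" for i
    proof -
      have "(\<Sum>j = 0..<n. M $$ (i, j) * v $ j) =
          (\<Sum>j = 0..<n. M $$ (i, j) * z j) - mean * (\<Sum>j = 0..<n. M $$ (i, j))"
        by (simp add: v_def algebra_simps sum_subtractf sum_distrib_left)
      also have "(\<Sum>j = 0..<n. M $$ (i, j)) = K" using row i unfolding n_def by blast
      finally have "(\<Sum>j = 0..<n. M $$ (i, j) * v $ j) =
          x * z i + (\<Sum>j = 0..<n. M $$ (0, j) * z j) - mean * K"
        by (simp only: Mz[OF i])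
      also have "\<dots> = x * v $ i + d" using i by (simp add: v_def d_def right_diff_distrib)
      finally show ?thesis .
    qed
    \<comment> \<open>Summing over all coordinates brings in the column sums: the total of
      \<open>M *\<^sub>v v\<close> is \<open>K\<close> times the sum of \<open>v\<close>, hence
      zero, and this forces \<open>n * d = 0\<close>.\<close>
    have "(\<Sum>i = 0..<n. \<Sum>j = 0..<n. M $$ (i, j) * v $ j) = (\<Sum>j = 0..<n. (\<Sum>i = 0..<n. M $$ (i, j)) * v $ j)"
      by (subst sum.swap) (simp add: sum_distrib_right)
    also have "\<dots> = (\<Sum>j = 0..<n. K * v $ j)"
      by (rule sum.cong) (use col in \<open>auto simp: n_def simp del: sum.op_ivl_Suc\<close>)
    also have "\<dots> = 0" by (simp add: sumv flip: sum_distrib_left)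
    finally have "(\<Sum>i = 0..<n. x * v $ i + d) = 0" using Mv by simp
    hence "real n * d = 0" by (simp add: sum.distrib sumv flip: sum_distrib_left)
    hence d0: "d = 0" by (simp add: n_def)
    have "v \<noteq> 0\<^sub>v n"
    proof
      assume v0: "v = 0\<^sub>v n"
      have zm: "z i = mean" if "i < n" for i
        using arg_cong[OF v0, of "\<lambda>v. v $ i"] that by (simp add: v_def)
      have "mean = 0" using zm[of 0] by (simp add: z_def n_def)
      hence "y $ i = 0" if "i < m" for i using zm[of "Suc i"] that by (simp add: z_def n_def)
      hence "y = 0\<^sub>v m" using y(1) by (intro eq_vecI) auto
      with y(2) show False by simp
    qed
    moreover have "M *\<^sub>v v = x \<cdot>\<^sub>v v"
    proof (rule eq_vecI)
      fix i assume "i < dim_vec (x \<cdot>\<^sub>v v)"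
      hence i: "i < n" by (simp add: v_def)
      have "(M *\<^sub>v v) $ i = (\<Sum>j = 0..<n. M $$ (i, j) * v $ j)"
        using i Mc by (simp add: scalar_prod_def v_def)
      thus "(M *\<^sub>v v) $ i = (x \<cdot>\<^sub>v v) $ i" using i Mv[OF i] d0 by (simp add: v_def)
    qed (use Mc in \<open>auto simp: v_def\<close>)
    ultimately show ?thesis using sumv by (intro bexI[of _ v]) (auto simp: n_def v_def simp del: sum.op_ivl_Suc)
  qed
  with fact show ?thesis by (rule that)
qed

section \<open>Intersection numbers and adjacency operators\<close>

context association_scheme
begin

abbreviation p :: "nat \<Rightarrow> nat \<Rightarrow> nat \<Rightarrow> nat" where
  "p \<equiv> intersection_number V c"

abbreviation k :: "nat \<Rightarrow> nat" where
  "k \<equiv> constituent_degree V c"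

lemma color_less: "\<lbrakk>u \<in> V; v \<in> V\<rbrakk> \<Longrightarrow> c u v < r"
  using surj_colors by fastforce

lemma color_occurs:
  assumes "t < r"
  obtains u v where "u \<in> V" "v \<in> V" "c u v = t"
proof -
  have "t \<in> case_prod c ` (V \<times> V)" using assms surj_colors by simp
  thus ?thesis using that by auto
qed

text \<open>The pair \<open>u\<close>, \<open>v\<close> realises its own color, so the number chosen
  by \<open>THE\<close> is unique.\<close>

lemma card_intersection:
  assumes "i < r" "j < r" "u \<in> V" "v \<in> V"
  shows "card {w \<in> V. c u w = i \<and> c w v = j} = p (c u v) i j"
proof -
  let ?Q = "\<lambda>q. \<forall>u' \<in> V. \<forall>v' \<in> V. c u' v' = c u v \<longrightarrow> card {w \<in> V. c u' w = i \<and> c w v' = j} = q"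
  obtain q where "?Q q"
    using regularity[OF assms(1,2) color_less[OF assms(3,4)]] by blast
  hence "?Q (THE q. ?Q q)"
    by (rule theI) (use assms \<open>?Q q\<close> in blast)
  thus ?thesis using assms(3,4) unfolding intersection_number_def by blast
qed

lemma intersection_number_commute:
  assumes "i < r" "j < r" "t < r"
  shows "p t i j = p t j i"
proof -
  obtain u v where uv: "u \<in> V" "v \<in> V" "c u v = t" using color_occurs[OF assms(3)] .
  have "p t i j = card {w \<in> V. c u w = i \<and> c w v = j}"
    using card_intersection[of i j u v] assms uv by simp
  also have "{w \<in> V. c u w = i \<and> c w v = j} = {w \<in> V. c v w = j \<and> c w u = i}"
    using uv symmetric_colors by auto
  also have "card \<dots> = p t j i"
    using card_intersection[of j i v u] assms uv symmetric_colors by simp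
  finally show ?thesis .
qed

lemma card_color_neighbours:
  assumes "i < r" "u \<in> V"
  shows "card {w \<in> V. c u w = i} = k i"
proof -
  have "{w \<in> V. c u w = i} = {w \<in> V. c u w = i \<and> c w u = i}"
    using assms symmetric_colors by auto
  thus ?thesis
    using card_intersection[of i i u u] assms diagonal[of u u] by (simp add: constituent_degree_def)
qed

lemma constituent_degree_pos:
  assumes "i < r"
  shows "k i > 0"
proof -
  obtain u v where uv: "u \<in> V" "v \<in> V" "c u v = i" using color_occurs[OF assms] .
  hence "v \<in> {w \<in> V. c u w = i}" by simp
  hence "card {w \<in> V. c u w = i} > 0" using finite_vertices by (auto simp: card_gt_0_iff)
  thus ?thesis using card_color_neighbours[OF assms uv(1)] by simp
qed

lemma sum_intersection_numbers:
  assumes "t < r" "i < r"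
  shows "(\<Sum>j<r. p t i j) = k i"
proof -
  obtain u v where uv: "u \<in> V" "v \<in> V" "c u v = t" using color_occurs[OF assms(1)] .
  have "(\<Sum>j<r. p t i j) = (\<Sum>j<r. card {w \<in> V. c u w = i \<and> c w v = j})"
    using assms uv card_intersection[of i _ u v] by simp
  also have "\<dots> = card (\<Union>j<r. {w \<in> V. c u w = i \<and> c w v = j})"
    by (rule card_UN_disjoint[symmetric]) (auto simp: finite_vertices)
  also have "(\<Union>j<r. {w \<in> V. c u w = i \<and> c w v = j}) = {w \<in> V. c u w = i}"
    using uv color_less by auto
  finally show ?thesis using card_color_neighbours assms uv by simp
qed

lemma intersection_number_0_right:
  assumes "t < r" "i < r"
  shows "p t i 0 = (if t = i then 1 else 0)"
proof -
  obtain u v where uv: "u \<in> V" "v \<in> V" "c u v = t" using color_occurs[OF assms(1)] .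
  have "{w \<in> V. c u w = i \<and> c w v = 0} = (if t = i then {v} else {})"
    using uv diagonal by auto
  thus ?thesis using card_intersection[of i 0 u v] assms uv by (auto split: if_splits)
qed

lemma intersection_number_0_left:
  assumes "i < r" "j < r"
  shows "p 0 i j = (if i = j then k i else 0)"
proof (cases "i = j")
  case False
  obtain u v where uv: "u \<in> V" "v \<in> V" "c u v = 0"
    using color_occurs[of 0] assms(1) by (metis gr_zeroI less_nat_zero_code)
  hence "{w \<in> V. c u w = i \<and> c w v = j} = {}"
    using False diagonal[of u v] symmetric_colors by auto
  hence "card {w \<in> V. c u w = i \<and> c w v = j} = 0" by (simp only: card.empty)
  thus ?thesis using card_intersection[of i j u v] assms uv False by simp
qed (simp add: constituent_degree_def)

text \<open>Double counting, for a fixed \<open>u\<close>, of the pairs \<open>(v, w)\<close> with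
  \<open>c u v = t\<close>, \<open>c u w = i\<close> and \<open>c v w = j\<close>.\<close>

lemma degree_mult_intersection_number:
  assumes "t < r" "i < r" "j < r"
  shows "k t * p t i j = k i * p i t j"
proof -
  obtain u v0 where "u \<in> V" "v0 \<in> V" "c u v0 = t" using color_occurs[OF assms(1)] .
  note u = \<open>u \<in> V\<close>
  have cnt: "card {w \<in> V. c u w = s \<and> c w v = j} = (\<Sum>w \<in> {w \<in> V. c u w = s}. if c w v = j then 1 else 0)"
    for s v
    by (subst sum.inter_filter[symmetric]) (simp_all add: finite_vertices)
  have "k t * p t i j = (\<Sum>v \<in> {v \<in> V. c u v = t}. card {w \<in> V. c u w = i \<and> c w v = j})"
    using card_color_neighbours[OF assms(1) u] card_intersection[OF assms(2,3) u] by simp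
  also have "\<dots> = (\<Sum>v \<in> {v \<in> V. c u v = t}. \<Sum>w \<in> {w \<in> V. c u w = i}. if c w v = j then 1 else 0)"
    by (simp only: cnt)
  also have "\<dots> = (\<Sum>w \<in> {w \<in> V. c u w = i}. \<Sum>v \<in> {v \<in> V. c u v = t}. if c v w = j then 1 else 0)"
    by (subst sum.swap) (intro sum.cong refl; use symmetric_colors in auto)
  also have "\<dots> = (\<Sum>w \<in> {w \<in> V. c u w = i}. card {v \<in> V. c u v = t \<and> c v w = j})"
    by (simp only: cnt)
  also have "\<dots> = k i * p i t j"
    using card_color_neighbours[OF assms(2) u] card_intersection[OF assms(1,3) u] by simp
  finally show ?thesis .
qed

text \<open>The adjacency operator of color \<open>i\<close>, acting on functions instead of indexed
  vectors, so that no enumeration of \<open>V\<close> enters the algebra. Values of \<open>f\<close>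
  outside \<open>V\<close> are ignored.\<close>

definition adj :: "nat \<Rightarrow> ('a \<Rightarrow> real) \<Rightarrow> 'a \<Rightarrow> real" where
  "adj i f u = (\<Sum>v \<in> V. if c u v = i then f v else 0)"

lemma adj_cong: "(\<And>v. v \<in> V \<Longrightarrow> f v = g v) \<Longrightarrow> adj i f u = adj i g u"
  unfolding adj_def by (rule sum.cong) auto

lemma adj_add: "adj i (\<lambda>v. f v + g v) u = adj i f u + adj i g u"
  unfolding adj_def sum.distrib[symmetric] by (rule sum.cong) auto

lemma adj_scale: "adj i (\<lambda>v. a * f v) u = a * adj i f u"
  unfolding adj_def sum_distrib_left by (rule sum.cong) auto

lemma adj_0: "u \<in> V \<Longrightarrow> adj 0 f u = f u"
proof -
  assume u: "u \<in> V"
  have "adj 0 f u = (\<Sum>v \<in> V. if v = u then f v else 0)"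
    unfolding adj_def by (rule sum.cong) (use u diagonal in auto)
  thus ?thesis using u finite_vertices by simp
qed

lemma sum_adj_colors: "u \<in> V \<Longrightarrow> (\<Sum>i<r. adj i f u) = sum f V"
proof -
  assume u: "u \<in> V"
  have "(\<Sum>i<r. adj i f u) = (\<Sum>v \<in> V. \<Sum>i<r. if c u v = i then f v else 0)"
    unfolding adj_def by (rule sum.swap)
  also have "\<dots> = sum f V" by (rule sum.cong) (use u color_less in auto)
  finally show ?thesis .
qed

lemma sum_adj_vertices:
  fixes f :: "'a \<Rightarrow> real"
  assumes "i < r"
  shows "sum (adj i f) V = k i * sum f V"
proof -
  have "sum (adj i f) V = (\<Sum>v \<in> V. \<Sum>u \<in> V. if c v u = i then f v else 0)"
    unfolding adj_def by (subst sum.swap) (intro sum.cong refl; use symmetric_colors in auto)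
  also have "\<dots> = (\<Sum>v \<in> V. k i * f v)"
    by (rule sum.cong) (use assms card_color_neighbours finite_vertices in
        \<open>auto simp flip: sum.inter_filter\<close>)
  finally show ?thesis by (simp add: sum_distrib_left)
qed

text \<open>Multiplication rule of the Bose-Mesner algebra: two-step walks from \<open>u\<close> are
  grouped by their endpoint \<open>v\<close>, and endpoints by \<open>c u v\<close>.\<close>

lemma adj_adj:
  assumes "i < r" "j < r" "u \<in> V"
  shows "adj i (adj j f) u = (\<Sum>t<r. p t i j * adj t f u)"
proof -
  have "adj i (adj j f) u = (\<Sum>w \<in> V. \<Sum>v \<in> V. if c u w = i \<and> c w v = j then f v else 0)"
    unfolding adj_def by (rule sum.cong) (auto intro!: sum.neutral)
  also have "\<dots> = (\<Sum>v \<in> V. \<Sum>w \<in> V. if c u w = i \<and> c w v = j then f v else 0)"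
    by (rule sum.swap)
  also have "\<dots> = (\<Sum>v \<in> V. p (c u v) i j * f v)"
    by (rule sum.cong) (use assms card_intersection finite_vertices in
        \<open>auto simp flip: sum.inter_filter\<close>)
  also have "\<dots> = (\<Sum>v \<in> V. \<Sum>t<r. p t i j * (if c u v = t then f v else 0))"
    by (rule sum.cong) (use assms color_less in \<open>auto simp: if_distrib[of "\<lambda>x. _ * x"] cong: if_cong\<close>)
  also have "\<dots> = (\<Sum>t<r. p t i j * adj t f u)"
    unfolding adj_def sum_distrib_left by (rule sum.swap)
  finally show ?thesis .
qed

lemma adj_commute:
  assumes "i < r" "j < r" "u \<in> V"
  shows "adj i (adj j f) u = adj j (adj i f) u"
  unfolding adj_adj[OF assms] adj_adj[OF assms(2,1,3)]
  by (rule sum.cong) (use intersection_number_commute[OF assms(1,2)] in auto)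

end

section \<open>Joint eigenvalues in rank 4\<close>

lemma sum_lessThan_4: "(\<Sum>t<4. g t) = g 0 + g 1 + g 2 + g (3 :: nat)" for g :: "nat \<Rightarrow> 'b :: comm_monoid_add"
  by (simp add: eval_nat_numeral)

locale rank4_scheme = association_scheme V c 4 for V :: "'a set" and c
begin

text \<open>The four operators add up to the all-ones operator, which kills zero-sum functions; this
  eliminates \<open>adj 3\<close>.\<close>

lemma adj_adj_zero_sum:
  assumes "i \<in> {1, 2}" "j \<in> {1, 2}" "u \<in> V" "sum f V = 0"
  shows "adj i (adj j f) u = (if i = j then real (k i) else 0) * f u + p 1 i j * adj 1 f u
    + p 2 i j * adj 2 f u - p 3 i j * (f u + adj 1 f u + adj 2 f u)"
proof -
  have ij: "i < 4" "j < 4" using assms by auto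
  have "adj 0 f u + adj 1 f u + adj 2 f u + adj 3 f u = 0"
    using sum_adj_colors[OF assms(3), of f] assms(4) unfolding sum_lessThan_4 by simp
  hence "adj 3 f u = - (f u + adj 1 f u + adj 2 f u)" using adj_0[OF assms(3), of f] by linarith
  thus ?thesis
    using intersection_number_0_left[OF ij] adj_0[OF assms(3), of f]
    unfolding adj_adj[OF ij assms(3)] sum_lessThan_4 by (simp add: right_diff_distrib distrib_left)
qed

text \<open>The zero sum excludes the constant eigenvector, which belongs to the degrees.
  Nonvanishing is asked for on \<open>V\<close> because values elsewhere are arbitrary.\<close>

definition joint_eigenvalues :: "real \<Rightarrow> real \<Rightarrow> bool" where
  "joint_eigenvalues x y \<longleftrightarrow> (\<exists>f. sum f V = 0 \<and> (\<exists>u \<in> V. f u \<noteq> 0) \<and>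
     (\<forall>u \<in> V. adj 1 f u = x * f u \<and> adj 2 f u = y * f u))"

lemma joint_eigenvalues_square:
  fixes x y :: real
  assumes "joint_eigenvalues x y"
  shows "x * x = k 1 + p 1 1 1 * x + p 2 1 1 * y - p 3 1 1 * (1 + x + y)"
proof -
  obtain f :: "'a \<Rightarrow> real" and u where f: "sum f V = 0" "u \<in> V" "f u \<noteq> 0"
    "\<And>v. v \<in> V \<Longrightarrow> adj 1 f v = x * f v" "\<And>v. v \<in> V \<Longrightarrow> adj 2 f v = y * f v"
    using assms unfolding joint_eigenvalues_def by blast
  have "adj 1 (adj 1 f) u = adj 1 (\<lambda>v. x * f v) u" by (rule adj_cong) (use f in auto)
  hence "x * x * f u = k 1 * f u + p 1 1 1 * adj 1 f u + p 2 1 1 * adj 2 f u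
      - p 3 1 1 * (f u + adj 1 f u + adj 2 f u)"
    using adj_adj_zero_sum[of 1 1 u f] f by (simp add: adj_scale)
  also have "\<dots> = (k 1 + p 1 1 1 * x + p 2 1 1 * y - p 3 1 1 * (1 + x + y)) * f u"
    using f by (simp add: algebra_simps)
  finally show ?thesis using f(3) by simp
qed

text \<open>Applying \<open>adj 1\<close> to \<open>adj 2 f = y * f\<close> turns the product rule
  into a linear equation for \<open>adj 1 f\<close>. Where the left coefficient is nonzero, every
  zero-sum eigenfunction of \<open>adj 2\<close> for \<open>y\<close> is one of \<open>adj 1\<close>
  too.\<close>

lemma adj_1_of_adj_2_eigenvector:
  fixes f :: "'a \<Rightarrow> real" and y :: real
  assumes "sum f V = 0" "\<And>v. v \<in> V \<Longrightarrow> adj 2 f v = y * f v" "u \<in> V"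
  shows "(y - p 1 1 2 + p 3 1 2) * adj 1 f u = (p 2 1 2 * y - p 3 1 2 * (1 + y)) * f u"
proof -
  have "adj 1 (adj 2 f) u = adj 1 (\<lambda>v. y * f v) u" by (rule adj_cong) (use assms in auto)
  hence "y * adj 1 f u = p 1 1 2 * adj 1 f u + p 2 1 2 * (y * f u)
      - p 3 1 2 * (f u + adj 1 f u + y * f u)"
    using adj_adj_zero_sum[of 1 2 u f] assms by (simp add: adj_scale)
  thus ?thesis by (simp add: algebra_simps)
qed

lemma joint_eigenvalues_product:
  fixes x y :: real
  assumes "joint_eigenvalues x y"
  shows "(y - p 1 1 2 + p 3 1 2) * x = p 2 1 2 * y - p 3 1 2 * (1 + y)"
proof -
  obtain f :: "'a \<Rightarrow> real" and u where f: "sum f V = 0" "u \<in> V" "f u \<noteq> 0"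
    "\<And>v. v \<in> V \<Longrightarrow> adj 1 f v = x * f v" "\<And>v. v \<in> V \<Longrightarrow> adj 2 f v = y * f v"
    using assms unfolding joint_eigenvalues_def by blast
  show ?thesis using adj_1_of_adj_2_eigenvector[OF f(1,5,2)] f by simp
qed

lemma k_1_pos: "k 1 > 0" and k_2_pos: "k 2 > 0"
  by (simp_all add: constituent_degree_pos)

text \<open>Take \<open>u\<close>, \<open>w\<close> of color 3 with a common X_1-neighbour
  \<open>v\<close>. Both sets \<open>S u\<close> and \<open>S w\<close> have size
  \<open>p 1 1 1\<close> and lie among the \<open>k 1\<close> neighbours of \<open>v\<close>, and
  they overlap in at most \<open>p 3 1 1\<close> vertices.\<close>

lemma intersection_number_111_le: "2 * p 1 1 1 \<le> k 1 + p 3 1 1" if "p 3 1 1 > 0"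
proof -
  obtain u w where uw: "u \<in> V" "w \<in> V" "c u w = 3" using color_occurs[of 3] by auto
  have "card {v \<in> V. c u v = 1 \<and> c v w = 1} > 0"
    using card_intersection[of 1 1 u w] uw that by simp
  then obtain v where v: "v \<in> V" "c u v = 1" "c v w = 1"
    by (metis (mono_tags, lifting) card_gt_0_iff ex_in_conv mem_Collect_eq)
  define S where "S x = {z \<in> V. c v z = 1 \<and> c z x = 1}" for x
  have fin: "finite (S x)" for x using finite_vertices by (simp add: S_def)
  have cS: "card (S u) = p 1 1 1" "card (S w) = p 1 1 1"
    using card_intersection[of 1 1 v u] card_intersection[of 1 1 v w] uw v symmetric_colors[of u v]
    by (simp_all add: S_def)
  have "card (S u \<union> S w) \<le> card {z \<in> V. c v z = 1}"
    by (rule card_mono) (auto simp: S_def finite_vertices)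
  moreover have "card (S u \<inter> S w) \<le> card {z \<in> V. c u z = 1 \<and> c z w = 1}"
    by (rule card_mono) (use uw symmetric_colors in \<open>auto simp: S_def finite_vertices\<close>)
  ultimately show ?thesis
    using card_Un_Int[OF fin fin, of u w] cS card_color_neighbours[of 1 v]
      card_intersection[of 1 1 u w] uw v by simp
qed

end

section \<open>Strongly regular X_2 with eigenvalue -2\<close>

locale rank4_srg_scheme = rank4_scheme +
  assumes mu_eq: "p 1 2 2 = p 3 2 2"
    and eigenvalue_minus_2:
      "\<exists>f :: 'a \<Rightarrow> real. sum f V = 0 \<and> (\<exists>u \<in> V. f u \<noteq> 0) \<and> (\<forall>u \<in> V. adj 2 f u = - 2 * f u)"
begin

text \<open>The quadratic equation of a strongly regular graph with lambda = \<open>p 2 2 2\<close>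
  and mu = \<open>p 3 2 2\<close>; its all-ones term vanishes on zero-sum functions.\<close>

lemma adj_2_adj_2:
  assumes "u \<in> V" "sum f V = 0"
  shows "adj 2 (adj 2 f) u =
    (real (k 2) - p 3 2 2) * f u + (real (p 2 2 2) - p 3 2 2) * adj 2 f u"
  using adj_adj_zero_sum[of 2 2 u f] assms mu_eq by (simp add: algebra_simps)

text \<open>This says that -2 is a root of the quadratic of \<open>adj_2_adj_2\<close>.\<close>

lemma lambda_mu: "4 = real (k 2) - 2 * real (p 2 2 2) + p 3 2 2"
proof -
  obtain f :: "'a \<Rightarrow> real" and u where f: "sum f V = 0" "u \<in> V" "f u \<noteq> 0" "\<And>v. v \<in> V \<Longrightarrow> adj 2 f v = (- 2) * f v"
    using eigenvalue_minus_2 by blast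
  have "adj 2 (adj 2 f) u = adj 2 (\<lambda>v. - 2 * f v) u" by (rule adj_cong) (use f in auto)
  hence "4 * f u = (real (k 2) - p 3 2 2) * f u + (real (p 2 2 2) - p 3 2 2) * (- 2 * f u)"
    using adj_2_adj_2[OF f(2,1)] f adj_scale[of 2 "-2" f u] by simp
  also have "\<dots> = (real (k 2) - 2 * real (p 2 2 2) + p 3 2 2) * f u" by (simp add: algebra_simps)
  finally show ?thesis using f(3) by (metis mult_right_cancel)
qed

text \<open>The other root of the quadratic: the product of the roots is
  \<open>- (k 2 - p 3 2 2)\<close> and one root is -2.\<close>

definition theta :: real where "theta = (real (k 2) - p 3 2 2) / 2"

text \<open>The quadratic factors as (\<open>adj 2\<close> -
  \<open>theta\<close>)(\<open>adj 2\<close> + 2) = 0, so \<open>adj 2\<close> + 2 maps zero-sum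
  functions into the eigenspace for \<open>theta\<close>.\<close>

lemma adj_2_shifted:
  assumes "u \<in> V" "sum f V = 0"
  shows "adj 2 (\<lambda>v. adj 2 f v + 2 * f v) u = theta * (adj 2 f u + 2 * f u)"
proof -
  have l: "real (p 2 2 2) = (real (k 2) + p 3 2 2) / 2 - 2" using lambda_mu by (simp add: field_simps)
  have "theta * (adj 2 f u + 2 * f u) =
      (real (k 2) - p 3 2 2) * f u + (real (p 2 2 2) - p 3 2 2) * adj 2 f u + 2 * adj 2 f u"
    unfolding l theta_def by (simp add: field_simps)
  thus ?thesis by (simp add: adj_add adj_scale adj_2_adj_2[OF assms])
qed

lemma sum_shifted: "sum f V = 0 \<Longrightarrow> (\<Sum>v \<in> V. adj 2 f v + 2 * f v) = 0"
  using sum_adj_vertices[of 2 f] by (simp add: sum.distrib flip: sum_distrib_left)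

text \<open>An eigenfunction of the sum may mix both eigenspaces of \<open>adj 2\<close>. Applying
  \<open>adj 2\<close> + 2 either leaves a nonzero eigenfunction for \<open>theta\<close>, still
  with eigenvalue \<open>\<xi>\<close> for the sum because the operators commute, or shows that
  \<open>f\<close> itself belongs to -2.\<close>

lemma joint_eigenvalues_of_sum_eigenvector:
  fixes f :: "'a \<Rightarrow> real"
  assumes "sum f V = 0" "\<exists>u \<in> V. f u \<noteq> 0" "\<And>u. u \<in> V \<Longrightarrow> adj 1 f u + adj 2 f u = \<xi> * f u"
  obtains x y where "joint_eigenvalues x y" "\<xi> = x + y" "y = - 2 \<or> y = theta"
proof (cases "\<exists>u \<in> V. adj 2 f u + 2 * f u \<noteq> 0")
  case True
  define g where "g v = adj 2 f v + 2 * f v" for v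
  have g2: "adj 2 g u = theta * g u" if "u \<in> V" for u
    using adj_2_shifted[OF that assms(1)] by (simp add: g_def[abs_def])
  have "adj 1 g u = (\<xi> - theta) * g u" if u: "u \<in> V" for u
  proof -
    have "adj 1 g u + adj 2 g u =
        (adj 1 (adj 2 f) u + adj 2 (adj 2 f) u) + 2 * (adj 1 f u + adj 2 f u)"
      by (simp add: g_def[abs_def] adj_add adj_scale)
    also have "adj 1 (adj 2 f) u + adj 2 (adj 2 f) u = adj 2 (\<lambda>v. adj 1 f v + adj 2 f v) u"
      using adj_commute[of 1 2 u f] u by (simp add: adj_add)
    also have "\<dots> = adj 2 (\<lambda>v. \<xi> * f v) u" by (rule adj_cong) (use assms in auto)
    also have "\<dots> = \<xi> * adj 2 f u" by (rule adj_scale)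
    also have "\<dots> + 2 * (adj 1 f u + adj 2 f u) = \<xi> * g u"
      unfolding assms(3)[OF u] by (simp add: g_def algebra_simps)
    finally show ?thesis unfolding g2[OF u] by (simp add: algebra_simps)
  qed
  with g2 True sum_shifted[OF assms(1)] have "joint_eigenvalues (\<xi> - theta) theta"
    unfolding joint_eigenvalues_def by (intro exI[of _ g]) (auto simp: g_def)
  thus ?thesis by (rule that) auto
next
  case False
  hence a2: "adj 2 f u = - 2 * f u" if "u \<in> V" for u using that by fastforce
  hence "adj 1 f u = (\<xi> + 2) * f u" if "u \<in> V" for u
    using assms(3)[OF that] that by (simp add: algebra_simps)
  with a2 assms(1,2) have "joint_eigenvalues (\<xi> + 2) (- 2)"
    unfolding joint_eigenvalues_def by blast
  thus ?thesis by (rule that) auto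
qed

text \<open>Start from the difference of two point masses at \<open>u\<close> and \<open>v\<close>
  of color 1. As \<open>u\<close> and \<open>v\<close> are not adjacent in X_2, \<open>adj 2\<close>
  + 2 sends it to a function with value 2 at \<open>u\<close>.\<close>

lemma theta_eigenvector:
  obtains f :: "'a \<Rightarrow> real" where "sum f V = 0" "\<exists>u \<in> V. f u \<noteq> 0" "\<And>u. u \<in> V \<Longrightarrow> adj 2 f u = theta * f u"
proof -
  obtain u v where uv: "u \<in> V" "v \<in> V" "c u v = 1" using color_occurs[of 1] by auto
  define e where "e w = (if w = u then 1 else 0) - (if w = v then 1 else (0 :: real))" for w
  have "u \<noteq> v" using diagonal[of u v] uv by auto
  have e0: "sum e V = 0" unfolding e_def sum_subtractf using uv finite_vertices by simp
  have "adj 2 e u = (\<Sum>w \<in> V. 0)" unfolding adj_def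
    by (rule sum.cong) (use uv diagonal[of u u] in \<open>auto simp: e_def\<close>)
  hence "adj 2 e u + 2 * e u \<noteq> 0" using \<open>u \<noteq> v\<close> by (simp add: e_def)
  with uv show ?thesis
    using that[of "\<lambda>v. adj 2 e v + 2 * e v"] sum_shifted[OF e0] adj_2_shifted[OF _ e0] by blast
qed

lemma k_1_mult_mu: "real (k 1) * p 3 2 2 = real (k 2) * p 2 1 2"
proof -
  have "real (k 1 * p 1 2 2) = real (k 2 * p 2 1 2)"
    using degree_mult_intersection_number[of 1 2 2] by simp
  thus ?thesis unfolding mu_eq by simp
qed

lemma k_2_mult_211: "real (k 2) * p 2 1 1 = real (k 1) * p 1 1 2"
proof -
  have "real (k 2 * p 2 1 1) = real (k 1 * p 1 2 1)"
    using degree_mult_intersection_number[of 2 1 1] by simp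
  thus ?thesis using intersection_number_commute[of 2 1 1] by simp
qed

text \<open>Double counting moves the upper index from 3 to 1; \<open>p 1 2 3\<close> is then what
  the other terms of \<open>sum_intersection_numbers\<close> leave of \<open>k 2\<close>. The next
  lemma treats mu in the same way.\<close>

lemma k_3_mult_312: "real (k 3) * p 3 1 2 = real (k 1) * (real (k 2) - p 1 1 2 - p 3 2 2)"
proof -
  have "real (k 3 * p 3 1 2) = real (k 1 * p 1 3 2)"
    using degree_mult_intersection_number[of 3 1 2] by simp
  moreover have "p 1 2 0 + p 1 2 1 + p 1 2 2 + p 1 2 3 = k 2"
    using sum_intersection_numbers[of 1 2] unfolding sum_lessThan_4 by simp
  moreover have "p 1 2 0 = 0" using intersection_number_0_right[of 1 2] by simp
  moreover have "p 1 2 1 = p 1 1 2" "p 1 3 2 = p 1 2 3"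
    using intersection_number_commute[of 2 1 1] intersection_number_commute[of 3 2 1] by simp_all
  ultimately have "real (k 3 * p 3 1 2) = real (k 1 * p 1 2 3)" "k 2 = p 1 1 2 + p 3 2 2 + p 1 2 3"
    using mu_eq by simp_all
  thus ?thesis by simp
qed

lemma k_3_mult_mu: "real (k 3) * p 3 2 2 = real (k 2) * (real (k 2) - 1 - p 2 1 2 - p 2 2 2)"
proof -
  have "real (k 3 * p 3 2 2) = real (k 2 * p 2 3 2)"
    using degree_mult_intersection_number[of 3 2 2] by simp
  moreover have "p 2 2 0 + p 2 2 1 + p 2 2 2 + p 2 2 3 = k 2"
    using sum_intersection_numbers[of 2 2] unfolding sum_lessThan_4 by simp
  moreover have "p 2 2 0 = 1" using intersection_number_0_right[of 2 2] by simp
  moreover have "p 2 2 1 = p 2 1 2" "p 2 3 2 = p 2 2 3"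
    using intersection_number_commute[of 2 1 2] intersection_number_commute[of 3 2 2] by simp_all
  ultimately have "real (k 3 * p 3 2 2) = real (k 2 * p 2 2 3)"
    "k 2 = 1 + p 2 1 2 + p 2 2 2 + p 2 2 3" by simp_all
  thus ?thesis by (simp add: algebra_simps)
qed

lemma k_3_mult_311: "real (k 3) * p 3 1 1 \<le> real (k 1) * k 1"
proof -
  have "real (k 3 * p 3 1 1) = real (k 1 * p 1 3 1)"
    using degree_mult_intersection_number[of 3 1 1] by simp
  moreover have "p 1 3 1 \<le> k 1"
    using sum_intersection_numbers[of 1 1] intersection_number_commute[of 3 1 1]
    unfolding sum_lessThan_4 by simp
  ultimately show ?thesis by (simp add: mult_left_mono)
qed

text \<open>On the eigenspace of \<open>X\<^sub>2\<close> for \<open>-2\<close> the matrix of \<open>X\<^sub>1\<close> acts as the rational scalar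
  \<open>(2 p\<^sup>2\<^sub>1\<^sub>2 - p\<^sup>3\<^sub>1\<^sub>2) / (2 + p\<^sup>1\<^sub>1\<^sub>2 - p\<^sup>3\<^sub>1\<^sub>2)\<close>. If the bound failed, this eigenvalue would lie strictly
  between 0 and 1, although it is an algebraic integer.\<close>

lemma intersection_number_112_le: "p 1 1 2 \<le> 2 * p 2 1 2"
proof (rule ccontr)
  assume "\<not> p 1 1 2 \<le> 2 * p 2 1 2"
  hence gt: "2 * real (p 2 1 2) < p 1 1 2" by linarith
  define x y where "x = 2 * real (p 2 1 2) - p 3 1 2" and "y = 2 + real (p 1 1 2) - p 3 1 2"
  \<comment> \<open>\<open>k_1_mult_mu\<close> trades \<open>k 2 * p 2 1 2\<close> for
    \<open>k 1 * p 3 2 2\<close>, to which \<open>k_3_mult_mu\<close> applies; then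
    \<open>k 2\<close> cancels.\<close>
  have s: "real (k 3) * p 2 1 2 = real (k 1) * (real (k 2) - 1 - p 2 1 2 - p 2 2 2)"
  proof -
    have "real (k 2) * (real (k 3) * p 2 1 2) = real (k 1) * (real (k 3) * p 3 2 2)"
      using k_1_mult_mu by (simp add: algebra_simps)
    also have "\<dots> = real (k 2) * (real (k 1) * (real (k 2) - 1 - p 2 1 2 - p 2 2 2))"
      by (simp add: k_3_mult_mu)
    finally show ?thesis using k_2_pos by simp
  qed
  \<comment> \<open>Positivity of the numerator becomes visible after scaling by \<open>k 3\<close>:
    by \<open>lambda_mu\<close> the bracket reduces to \<open>y - x\<close>.\<close>
  have "real (k 3) * x = 2 * (real (k 3) * p 2 1 2) - real (k 3) * p 3 1 2"
    by (simp add: x_def algebra_simps)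
  also have "\<dots> = real (k 1) * (real (k 2) - 2 * real (p 2 2 2) + p 3 2 2 - 2 - 2 * real (p 2 1 2) + p 1 1 2)"
    unfolding s k_3_mult_312 by (simp add: algebra_simps)
  also have "\<dots> = real (k 1) * (2 + real (p 1 1 2) - 2 * real (p 2 1 2))"
    using lambda_mu by simp
  finally have "real (k 3) * x > 0" using gt k_1_pos by simp
  hence x0: "x > 0" by (simp add: zero_less_mult_iff)
  have xy: "x < y" using gt by (simp add: x_def y_def)
  define t where "t = x / y"
  have t: "0 < t" "t < 1" using x0 xy by (simp_all add: t_def)
  obtain f :: "'a \<Rightarrow> real" and u where f: "sum f V = 0" "u \<in> V" "f u \<noteq> 0" "\<And>v. v \<in> V \<Longrightarrow> adj 2 f v = (- 2) * f v"
    using eigenvalue_minus_2 by blast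
  have "adj 1 f v = t * f v" if "v \<in> V" for v
  proof -
    have "y * adj 1 f v = x * f v"
      using adj_1_of_adj_2_eigenvector[OF f(1,4) that] by (simp add: x_def y_def algebra_simps)
    thus ?thesis using x0 xy by (simp add: t_def field_simps)
  qed
  hence "joint_eigenvalues t (- 2)" unfolding joint_eigenvalues_def using f by blast
  from joint_eigenvalues_square[OF this]
  have t2: "t * t = k 1 + p 1 1 1 * t - 2 * real (p 2 1 1) - p 3 1 1 * (t - 1)" by (simp add: algebra_simps)
  \<comment> \<open>The relation for the square of \<open>adj 1\<close> is a monic integer quadratic
    satisfied by \<open>t\<close>; a rational root of it is an integer, and none lies strictly
    between 0 and 1.\<close>
  have "algebraic_int t"
  proof (rule algebraic_int.intros)
    let ?q = "[:- (real (k 1) - 2 * real (p 2 1 1) + p 3 1 1), - (real (p 1 1 1) - p 3 1 1), 1:]"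
    show "lead_coeff ?q = 1" by simp
    show "\<forall>i. coeff ?q i \<in> \<int>" by (auto simp: coeff_pCons split: nat.split)
    show "poly ?q t = 0" using t2 by (simp add: algebra_simps)
  qed
  moreover have "t \<in> \<rat>" by (simp add: t_def x_def y_def)
  ultimately have "t \<in> \<int>" by (rule rational_algebraic_int_is_int)
  then obtain z where "t = of_int z" by (elim Ints_cases)
  with t show False by simp
qed

end

section \<open>Bounds when the third degree dominates\<close>

text \<open>The two positivity assumptions come from X_1 and X_2 having diameter at most 2, applied
  to a pair of color 3. The ratio \<open>100000\<close> follows from the bound on
  \<open>\<epsilon>\<close> and is large enough to turn the color-3 numbers into error terms against
  margins of about one percent.\<close>

locale small_rank4_srg_scheme = rank4_srg_scheme +
  assumes p_311_pos: "p 3 1 1 > 0" and p_322_pos: "p 3 2 2 > 0"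
    and k_1_le_k_2: "k 1 \<le> k 2"
    and k_3_large: "100000 * real (k 2) \<le> real (k 3)"
begin

lemma le_of_k_3_mult_le:
  fixes x :: real
  assumes "real (k 3) * x \<le> real (k 2) * real (k 2)" "x \<ge> 0"
  shows "100000 * x \<le> real (k 2)"
proof -
  have "(100000 * real (k 2)) * x \<le> real (k 3) * x"
    using k_3_large assms(2) by (rule mult_right_mono)
  with assms(1) have "real (k 2) * (100000 * x) \<le> real (k 2) * real (k 2)" by (simp add: mult_ac)
  thus ?thesis using k_2_pos by simp
qed

text \<open>The identities for \<open>k 3\<close> times a color-3 number give the first three
  bounds. The rest are reduced to mu: \<open>p 2 1 2\<close> by \<open>k_1_mult_mu\<close>,
  \<open>p 1 1 2\<close> by the integrality argument, and \<open>p 2 1 1\<close> by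
  \<open>k_2_mult_211\<close>.\<close>

lemma small_intersection_numbers:
  shows "100000 * real (p 3 2 2) \<le> k 2" "100000 * real (p 3 1 2) \<le> k 2"
    "100000 * real (p 3 1 1) \<le> k 2" "real (p 2 1 2) \<le> p 3 2 2"
    "real (p 1 1 2) \<le> 2 * real (p 3 2 2)" "real (p 2 1 1) \<le> 2 * real (p 3 2 2)"
proof -
  have k: "0 < real (k 1)" "real (k 1) \<le> real (k 2)" using k_1_pos k_1_le_k_2 by simp_all
  have "real (k 3) * p 3 2 2 \<le> real (k 2) * real (k 2)"
    unfolding k_3_mult_mu by (rule mult_left_mono) simp_all
  thus "100000 * real (p 3 2 2) \<le> k 2" by (rule le_of_k_3_mult_le) simp
  have "real (k 3) * p 3 1 2 \<le> real (k 1) * real (k 2)"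
    unfolding k_3_mult_312 by (rule mult_left_mono) simp_all
  also have "\<dots> \<le> real (k 2) * real (k 2)" using k(2) by (rule mult_right_mono) simp
  finally show "100000 * real (p 3 1 2) \<le> k 2" by (rule le_of_k_3_mult_le) simp
  have "real (k 3) * p 3 1 1 \<le> real (k 1) * real (k 1)" by (rule k_3_mult_311)
  also have "\<dots> \<le> real (k 2) * real (k 2)" using k by (intro mult_mono) simp_all
  finally show "100000 * real (p 3 1 1) \<le> k 2" by (rule le_of_k_3_mult_le) simp
  have "real (k 2) * p 2 1 2 \<le> real (k 2) * p 3 2 2"
    unfolding k_1_mult_mu[symmetric] using k(2) by (rule mult_right_mono) simp
  thus s: "real (p 2 1 2) \<le> p 3 2 2" using k_2_pos by simp
  have "real (p 1 1 2) \<le> 2 * real (p 2 1 2)" using intersection_number_112_le by linarith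
  with s show P: "real (p 1 1 2) \<le> 2 * real (p 3 2 2)" by linarith
  have "real (k 2) * p 2 1 1 \<le> real (k 2) * p 1 1 2"
    unfolding k_2_mult_211 using k(2) by (rule mult_right_mono) simp
  hence "real (p 2 1 1) \<le> p 1 1 2" using k_2_pos by simp
  with P show "real (p 2 1 1) \<le> 2 * real (p 3 2 2)" by linarith
qed

text \<open>Mu is a positive integer, so its relative bound becomes an absolute one for
  \<open>k 2\<close>, which absorbs additive constants later.\<close>

lemma k_2_large: "100000 \<le> real (k 2)"
  using small_intersection_numbers(1) p_322_pos by linarith

text \<open>Each color has at most one large term, about half of \<open>k 2\<close>:
  \<open>p 1 1 1\<close> for \<open>t = 1\<close>, bounded by
  \<open>intersection_number_111_le\<close>, and \<open>p 2 2 2\<close> for \<open>t = 2\<close>,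
  bounded by \<open>lambda_mu\<close>. For \<open>t = 3\<close> all terms are small.\<close>

lemma common_neighbours_12_le:
  assumes "t \<in> {1, 2, 3}"
  shows "real (p t 1 1 + 2 * p t 1 2 + p t 2 2) \<le> 51 / 100 * k 2"
proof -
  have a: "2 * real (p 1 1 1) \<le> real (k 2) + p 3 1 1"
    using intersection_number_111_le p_311_pos k_1_le_k_2 by linarith
  have m: "real (p 1 2 2) = p 3 2 2" by (simp only: mu_eq)
  consider "t = 1" | "t = 2" | "t = 3" using assms by blast
  thus ?thesis
  proof cases
    case 1
    have "real (p 1 1 1) + 2 * real (p 1 1 2) + real (p 1 2 2) \<le> 51 / 100 * real (k 2)"
      using small_intersection_numbers a m k_2_large by linarith
    thus ?thesis unfolding 1 by simp
  next
    case 2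
    have "real (p 2 1 1) + 2 * real (p 2 1 2) + real (p 2 2 2) \<le> 51 / 100 * real (k 2)"
      using small_intersection_numbers lambda_mu k_2_large by linarith
    thus ?thesis unfolding 2 by simp
  next
    case 3
    have "real (p 3 1 1) + 2 * real (p 3 1 2) + real (p 3 2 2) \<le> 51 / 100 * real (k 2)"
      using small_intersection_numbers k_2_large by linarith
    thus ?thesis unfolding 3 by simp
  qed
qed

lemma theta_bounds: "49 / 100 * real (k 2) \<le> theta" "theta \<le> real (k 2) / 2"
  using small_intersection_numbers(1) k_2_large unfolding theta_def by (simp_all add: field_simps)

lemma theta_coefficient: "48 / 100 * real (k 2) \<le> theta - p 1 1 2 + p 3 1 2"
  using small_intersection_numbers theta_bounds k_2_large by linarith

text \<open>At \<open>theta\<close> the product relation can be solved for \<open>x\<close>: the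
  coefficient of \<open>x\<close> is almost half of \<open>k 2\<close>, while the right side is a
  small intersection number times a quantity of order \<open>k 2\<close>.\<close>

lemma joint_eigenvalues_theta_bound:
  assumes "joint_eigenvalues x theta"
  shows "\<bar>x\<bar> \<le> real (k 2) / 100"
proof -
  define y where "y = theta - p 1 1 2 + p 3 1 2"
  have y: "48 / 100 * real (k 2) \<le> y" using theta_coefficient by (simp add: y_def)
  have k2: "real (k 2) > 0" using k_2_pos by simp
  have "\<bar>p 2 1 2 * theta - p 3 1 2 * (1 + theta)\<bar> \<le> real (p 2 1 2) * theta + real (p 3 1 2) * (1 + theta)"
    using theta_bounds(1) k2 by (simp add: abs_if)
  also have "\<dots> \<le> real (k 2) / 100000 * real (k 2) + real (k 2) / 100000 * real (k 2)"
    by (intro add_mono mult_mono) (use small_intersection_numbers theta_bounds k_2_large in linarith)+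
  also have "\<dots> = 2 / 100000 * (real (k 2) * real (k 2))" by simp
  also have "\<dots> \<le> 48 / 10000 * (real (k 2) * real (k 2))" by (rule mult_right_mono) simp_all
  also have "\<dots> = 48 / 100 * real (k 2) * (real (k 2) / 100)" by simp
  also have "\<dots> \<le> y * (real (k 2) / 100)" using y by (rule mult_right_mono) simp
  finally have "\<bar>y * x\<bar> \<le> y * (real (k 2) / 100)"
    using joint_eigenvalues_product[OF assms] by (simp add: y_def)
  moreover have "y > 0" using y k2 by linarith
  ultimately show ?thesis by (simp add: abs_mult)
qed

text \<open>Here the relation for the square of \<open>x\<close> is used: up to an error of at most
  \<open>2 * k 2\<close> it reads \<open>x * x = a * x\<close> with \<open>a\<close> at most about
  half of \<open>k 2\<close> in absolute value.\<close>

lemma joint_eigenvalues_minus_2_bound: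
  assumes "joint_eigenvalues x (- 2)"
  shows "\<bar>x\<bar> \<le> 6 / 10 * real (k 2)"
proof (rule ccontr)
  assume "\<not> ?thesis"
  hence big: "6 / 10 * real (k 2) < \<bar>x\<bar>" by simp
  define K where "K = real (k 2)"
  define a where "a = real (p 1 1 1) - p 3 1 1"
  have K: "K \<ge> 100000" using k_2_large by (simp add: K_def)
  have aK: "\<bar>a\<bar> \<le> 51 / 100 * K"
    using intersection_number_111_le[OF p_311_pos] small_intersection_numbers(3) k_1_le_k_2 k_2_large
    unfolding K_def a_def by linarith
  have "x * x = k 1 + a * x - 2 * real (p 2 1 1) + p 3 1 1"
    using joint_eigenvalues_square[OF assms] by (simp add: a_def algebra_simps)
  also have "\<dots> \<le> 2 * K + a * x"
    using k_1_le_k_2 small_intersection_numbers(3) k_2_large unfolding K_def by linarith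
  also have "a * x \<le> \<bar>a\<bar> * \<bar>x\<bar>" by (metis abs_ge_self abs_mult)
  also have "\<dots> \<le> 51 / 100 * K * \<bar>x\<bar>" using aK by (rule mult_right_mono) simp
  finally have "\<bar>x\<bar> * (\<bar>x\<bar> - 51 / 100 * K) \<le> 2 * K" by (simp add: algebra_simps)
  \<comment> \<open>Beyond \<open>6 / 10 * K\<close> the left factor and its excess over
    \<open>51 / 100 * K\<close> give a product quadratic in \<open>K\<close>, which exceeds
    \<open>2 * K\<close> since \<open>K\<close> is at least \<open>100000\<close>.\<close>
  moreover have "(6 / 10 * K) * (9 / 100 * K) \<le> \<bar>x\<bar> * (\<bar>x\<bar> - 51 / 100 * K)"
    using big K unfolding K_def[symmetric] by (intro mult_mono) auto
  moreover have "K * 100000 \<le> K * K" using K by (intro mult_left_mono) auto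
  ultimately show False using K by simp
qed

lemma sum_eigenvalue_bound:
  fixes f :: "'a \<Rightarrow> real"
  assumes "sum f V = 0" "\<exists>u \<in> V. f u \<noteq> 0" "\<And>u. u \<in> V \<Longrightarrow> adj 1 f u + adj 2 f u = \<xi> * f u"
  shows "\<bar>\<xi>\<bar> \<le> 61 / 100 * real (k 2)"
proof -
  obtain x y where xy: "joint_eigenvalues x y" "\<xi> = x + y" "y = - 2 \<or> y = theta"
    using joint_eigenvalues_of_sum_eigenvector[OF assms] .
  from xy(3) show ?thesis
  proof
    assume "y = - 2"
    with joint_eigenvalues_minus_2_bound[of x] xy(1) have "\<bar>x\<bar> \<le> 6 / 10 * real (k 2)" by simp
    with \<open>y = - 2\<close> xy(2) k_2_large show ?thesis by linarith
  next
    assume "y = theta"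
    with joint_eigenvalues_theta_bound[of x] xy(1) have "\<bar>x\<bar> \<le> real (k 2) / 100" by simp
    with \<open>y = theta\<close> xy(2) theta_bounds k_2_large show ?thesis by linarith
  qed
qed

text \<open>This keeps the set under \<open>Max\<close> in the zero-weight spectral radius from
  being empty. The eigenfunction for \<open>theta\<close> serves, since there \<open>adj 1\<close>
  acts as the scalar \<open>z / y\<close>.\<close>

lemma sum_eigenvector_exists:
  obtains f :: "'a \<Rightarrow> real" and \<xi> where "sum f V = 0" "\<exists>u \<in> V. f u \<noteq> 0"
    "\<And>u. u \<in> V \<Longrightarrow> adj 1 f u + adj 2 f u = \<xi> * f u"
proof -
  obtain f :: "'a \<Rightarrow> real" where f: "sum f V = 0" "\<exists>u \<in> V. f u \<noteq> 0" "\<And>u. u \<in> V \<Longrightarrow> adj 2 f u = theta * f u"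
    using theta_eigenvector by blast
  define y z where "y = theta - p 1 1 2 + p 3 1 2" and "z = p 2 1 2 * theta - p 3 1 2 * (1 + theta)"
  have y: "y \<noteq> 0" using theta_coefficient k_2_large unfolding y_def by linarith
  have "adj 1 f u + adj 2 f u = (z / y + theta) * f u" if "u \<in> V" for u
  proof -
    have "y * adj 1 f u = z * f u"
      using adj_1_of_adj_2_eigenvector[OF f(1,3) that] by (simp add: y_def z_def)
    hence "adj 1 f u = z / y * f u" using y by (simp add: field_simps)
    thus ?thesis using f(3)[OF that] by (simp add: distrib_right)
  qed
  with f show ?thesis using that by blast
qed

end

section \<open>Color graphs and their adjacency matrices\<close>

context association_scheme
begin

lemma pverts_color_graph: "pverts (color_graph V c I) = V"
  by (simp add: color_graph_def)

lemma parcs_color_graph: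
  "(u, v) \<in> parcs (color_graph V c I) \<longleftrightarrow> u \<in> V \<and> v \<in> V \<and> u \<noteq> v \<and> c u v \<in> I"
  by (auto simp: color_graph_def)

text \<open>A pair of color \<open>t\<close> is distinct and non-adjacent in X_i, so a walk with
  fewer than three arcs between its vertices has exactly two, and its midpoint is counted by
  \<open>p t i i\<close>.\<close>

lemma intersection_number_pos_if_diameter_le_2:
  assumes "graph_diameter (with_proj (constituent V c i)) \<le> 2"
    and "t < r" "i < r" "t \<noteq> 0" "t \<noteq> i"
  shows "p t i i > 0"
proof -
  let ?G = "with_proj (constituent V c i)"
  interpret pair_graph "constituent V c i" by (rule pair_graph_color_graph)
  obtain u v where uv: "u \<in> V" "v \<in> V" "c u v = t" using color_occurs[OF assms(2)] .
  have "wf_digraph.\<mu> ?G (\<lambda>_. 1) u v \<le> graph_diameter ?G"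
    unfolding graph_diameter_def
    by (rule SUP_upper2[of "(u, v)"]) (use uv in \<open>auto simp: pverts_color_graph\<close>)
  also have "\<dots> \<le> 2" by (rule assms)
  also have "(2 :: ereal) < 3" by simp
  finally have "wf_digraph.\<mu> ?G (\<lambda>_. 1) u v < 3" .
  \<comment> \<open>The distance is an infimum of walk costs; the strict bound 3 yields an actual
    walk below it.\<close>
  then obtain q where q: "awalk u q v" "ereal (awalk_cost (\<lambda>_. 1) q) < 3"
    unfolding \<mu>_def INF_less_iff by auto
  have "awalk_cost (\<lambda>_. 1) q = length q"
    by (induction q) auto
  with q(2) have len: "length q < 3" by simp
  have uv': "u \<noteq> v" "(u, v) \<notin> parcs (constituent V c i)"
    using assms(4,5) uv diagonal[of u v] by (auto simp: parcs_color_graph)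
  obtain w where "(u, w) \<in> parcs (constituent V c i)" "(w, v) \<in> parcs (constituent V c i)"
  proof (cases q)
    case Nil
    with q(1) uv' show ?thesis by (auto simp: awalk_def)
  next
    case (Cons a q')
    note q1 = this
    show ?thesis
    proof (cases q')
      case Nil
      with q(1) q1 uv' show ?thesis by (auto simp: awalk_simps)
    next
      case (Cons b q'')
      with len q1 have "q = [a, b]" by simp
      with q(1) have "(u, snd a) \<in> parcs (constituent V c i)" "(snd a, v) \<in> parcs (constituent V c i)"
        by (auto simp: awalk_simps) (metis prod.collapse)+
      thus ?thesis by (rule that)
    qed
  qed
  hence "w \<in> {w \<in> V. c u w = i \<and> c w v = i}" by (auto simp: parcs_color_graph)
  hence "card {w \<in> V. c u w = i \<and> c w v = i} > 0"
    using finite_vertices by (auto simp: card_gt_0_iff)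
  thus ?thesis using card_intersection[of i i u v] assms uv by simp
qed

lemma common_neighbours_color_graph:
  assumes "u \<in> V" "v \<in> V" "0 \<notin> I"
  shows "common_neighbours (with_proj (color_graph V c I)) u v = {w \<in> V. c u w \<in> I \<and> c w v \<in> I}"
proof (rule Set.set_eqI)
  fix w
  show "w \<in> common_neighbours (with_proj (color_graph V c I)) u v \<longleftrightarrow>
      w \<in> {w \<in> V. c u w \<in> I \<and> c w v \<in> I}"
    using assms symmetric_colors[of v w] diagonal[of u w] diagonal[of v w]
    by (auto simp: common_neighbours_def pverts_color_graph parcs_color_graph)
qed

lemma card_common_neighbours_color_graph:
  assumes "u \<in> V" "v \<in> V" "I \<subseteq> {1..<r}"
  shows "card (common_neighbours (with_proj (color_graph V c I)) u v) =
    (\<Sum>i \<in> I. \<Sum>j \<in> I. p (c u v) i j)"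
proof -
  have fI: "finite I" using assms(3) finite_subset by blast
  have I: "i < r" if "i \<in> I" for i using that assms(3) by auto
  have "{w \<in> V. c u w \<in> I \<and> c w v \<in> I} = (\<Union>(i, j) \<in> I \<times> I. {w \<in> V. c u w = i \<and> c w v = j})"
    by auto
  also have "card \<dots> = (\<Sum>(i, j) \<in> I \<times> I. card {w \<in> V. c u w = i \<and> c w v = j})"
    using fI finite_vertices by (subst card_UN_disjoint) (auto intro: sum.cong)
  also have "\<dots> = (\<Sum>(i, j) \<in> I \<times> I. p (c u v) i j)"
    using assms(1,2) I by (auto intro!: sum.cong card_intersection)
  finally have "card {w \<in> V. c u w \<in> I \<and> c w v \<in> I} = (\<Sum>i \<in> I. \<Sum>j \<in> I. p (c u v) i j)"
    by (simp add: sum.cartesian_product)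
  moreover have "0 \<notin> I" using assms(3) by auto
  ultimately show ?thesis by (simp add: common_neighbours_color_graph[OF assms(1,2)])
qed

section \<open>Transfer between adjacency matrices and the operators \<open>adj\<close>\<close>

lemma adjacency_matrix_carrier:
  "adjacency_matrix (with_proj (color_graph V c I)) \<in> carrier_mat (card V) (card V)"
  by (simp add: adjacency_matrix_def pverts_color_graph)

lemma vertex_of_index: "i < card V \<Longrightarrow> from_nat_into V i \<in> V"
  by (rule from_nat_into) auto

lemma adjacency_matrix_symmetric:
  assumes "i < card V" "j < card V"
  shows "adjacency_matrix (with_proj (color_graph V c I)) $$ (i, j) =
    adjacency_matrix (with_proj (color_graph V c I)) $$ (j, i)"
  using assms symmetric_colors[of "from_nat_into V i" "from_nat_into V j"] vertex_of_index
  by (auto simp: adjacency_matrix_def pverts_color_graph parcs_color_graph)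

lemma adjacency_matrix_sum:
  fixes g :: "'a \<Rightarrow> real"
  assumes "i < card V" "I \<subseteq> {1..<r}"
  shows "(\<Sum>j = 0..<card V. adjacency_matrix (with_proj (color_graph V c I)) $$ (i, j) * g (from_nat_into V j))
    = (\<Sum>t \<in> I. adj t g (from_nat_into V i))"
proof -
  define u where "u = from_nat_into V i"
  have u: "u \<in> V" using vertex_of_index assms(1) by (simp add: u_def)
  have fI: "finite I" using assms(2) finite_subset by blast
  have "(\<Sum>j = 0..<card V. adjacency_matrix (with_proj (color_graph V c I)) $$ (i, j) * g (from_nat_into V j))
      = (\<Sum>j<card V. (if c u (from_nat_into V j) \<in> I then g (from_nat_into V j) else 0))"
    unfolding lessThan_atLeast0
  proof (rule sum.cong)
    fix j assume "j \<in> {0..<card V}"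
    moreover have "0 \<notin> I" using assms(2) by auto
    ultimately show "adjacency_matrix (with_proj (color_graph V c I)) $$ (i, j) * g (from_nat_into V j) =
        (if c u (from_nat_into V j) \<in> I then g (from_nat_into V j) else 0)"
      using assms u vertex_of_index[of j] diagonal[of u "from_nat_into V j"]
      by (auto simp: adjacency_matrix_def pverts_color_graph parcs_color_graph u_def)
  qed simp
  also have "\<dots> = (\<Sum>v \<in> V. if c u v \<in> I then g v else 0)"
    by (rule sum.card_from_nat_into)
  also have "\<dots> = (\<Sum>v \<in> V. \<Sum>t \<in> I. if c u v = t then g v else 0)"
    by (rule sum.cong) (use fI in auto)
  also have "\<dots> = (\<Sum>t \<in> I. adj t g u)" unfolding adj_def by (rule sum.swap)
  finally show ?thesis by (simp add: u_def)
qed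

lemma adjacency_matrix_line_sum:
  assumes "i < card V" "I \<subseteq> {1..<r}"
  shows "(\<Sum>j = 0..<card V. adjacency_matrix (with_proj (color_graph V c I)) $$ (i, j)) = (\<Sum>t \<in> I. real (k t))"
proof -
  have "adj t (\<lambda>_. 1) (from_nat_into V i) = k t" if "t \<in> I" for t
    using card_color_neighbours[of t "from_nat_into V i"] vertex_of_index[OF assms(1)] assms(2) that
      finite_vertices by (auto simp: adj_def simp flip: sum.inter_filter)
  thus ?thesis using adjacency_matrix_sum[OF assms, of "\<lambda>_. 1"] by simp
qed

text \<open>The vector is read as a function through the enumeration of \<open>V\<close>. The sum is
  carried along so that zero-sum eigenvectors give zero-sum eigenfunctions.\<close>

lemma eigenfunction_of_eigenvector:
  fixes v :: "real vec"
  assumes "v \<in> carrier_vec (card V)" "v \<noteq> 0\<^sub>v (card V)" "I \<subseteq> {1..<r}"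
    and "adjacency_matrix (with_proj (color_graph V c I)) *\<^sub>v v = x \<cdot>\<^sub>v v"
  obtains f :: "'a \<Rightarrow> real" where "sum f V = (\<Sum>i = 0..<card V. v $ i)" "\<exists>u \<in> V. f u \<noteq> 0"
    "\<And>u. u \<in> V \<Longrightarrow> (\<Sum>t \<in> I. adj t f u) = x * f u"
proof -
  define f where "f u = v $ to_nat_on V u" for u
  have f: "f (from_nat_into V i) = v $ i" if "i < card V" for i
  proof -
    have "i \<in> to_nat_on V ` V" using to_nat_on_finite[OF finite_vertices] that by (auto simp: bij_betw_def)
    thus ?thesis by (simp add: f_def)
  qed
  have "sum f V = (\<Sum>i<card V. f (from_nat_into V i))" by (rule sum.card_from_nat_into[symmetric])
  also have "\<dots> = (\<Sum>i = 0..<card V. v $ i)" unfolding lessThan_atLeast0 using f by simp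
  finally have "sum f V = (\<Sum>i = 0..<card V. v $ i)" .
  moreover have "\<exists>u \<in> V. f u \<noteq> 0"
  proof (rule ccontr)
    assume no: "\<not> ?thesis"
    have "v $ i = 0" if "i < card V" for i
      using no vertex_of_index[OF that] f[OF that] by auto
    hence "v = 0\<^sub>v (card V)" using assms(1) by (intro eq_vecI) auto
    with assms(2) show False by simp
  qed
  moreover have "(\<Sum>t \<in> I. adj t f u) = x * f u" if "u \<in> V" for u
  proof -
    obtain i where i: "i < card V" "u = from_nat_into V i"
      using bij_betw_from_nat_into_finite[OF finite_vertices] \<open>u \<in> V\<close> by (auto simp: bij_betw_def)
    have "x * f u = (adjacency_matrix (with_proj (color_graph V c I)) *\<^sub>v v) $ i"
      using assms i f by simp
    also have "\<dots> = (\<Sum>j = 0..<card V. adjacency_matrix (with_proj (color_graph V c I)) $$ (i, j) * f (from_nat_into V j))"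
      using assms(1) i adjacency_matrix_carrier[of I] f by (simp add: scalar_prod_def)
    also have "\<dots> = (\<Sum>t \<in> I. adj t f u)" using adjacency_matrix_sum[OF i(1) assms(3)] i by simp
    finally show ?thesis by simp
  qed
  ultimately show ?thesis by (rule that)
qed

lemma eigenvalue_of_eigenfunction:
  fixes f :: "'a \<Rightarrow> real"
  assumes "\<exists>u \<in> V. f u \<noteq> 0" "\<And>u. u \<in> V \<Longrightarrow> (\<Sum>t \<in> I. adj t f u) = x * f u" "I \<subseteq> {1..<r}"
  shows "eigenvalue (adjacency_matrix (with_proj (color_graph V c I))) x"
proof -
  let ?A = "adjacency_matrix (with_proj (color_graph V c I))"
  define v where "v = vec (card V) (\<lambda>i. f (from_nat_into V i))"
  obtain u where u: "u \<in> V" "f u \<noteq> 0" using assms(1) by blast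
  obtain i where i: "i < card V" "u = from_nat_into V i"
    using bij_betw_from_nat_into_finite[OF finite_vertices] u by (auto simp: bij_betw_def)
  have "v $ i \<noteq> 0" using i u by (simp add: v_def)
  hence "v \<noteq> 0\<^sub>v (card V)" using i by auto
  moreover have "?A *\<^sub>v v = x \<cdot>\<^sub>v v"
  proof (rule eq_vecI)
    fix i assume "i < dim_vec (x \<cdot>\<^sub>v v)"
    hence i: "i < card V" by (simp add: v_def)
    have "(?A *\<^sub>v v) $ i = (\<Sum>j = 0..<card V. ?A $$ (i, j) * f (from_nat_into V j))"
      using i adjacency_matrix_carrier[of I] by (simp add: scalar_prod_def v_def)
    also have "\<dots> = x * f (from_nat_into V i)"
      using adjacency_matrix_sum[OF i assms(3)] assms(2) vertex_of_index[OF i] by simp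
    finally show "(?A *\<^sub>v v) $ i = (x \<cdot>\<^sub>v v) $ i" using i by (simp add: v_def)
  qed (use adjacency_matrix_carrier[of I] in \<open>simp add: v_def\<close>)
  ultimately have "eigenvector ?A v x"
    using adjacency_matrix_carrier[of I] by (auto simp: eigenvector_def v_def)
  thus ?thesis unfolding eigenvalue_def by blast
qed

text \<open>\<open>Min\<close> is attained because the spectrum is finite and contains the degree,
  an eigenvalue with constant eigenfunction.\<close>

lemma eigenvalue_smallest_eigenvalue:
  assumes "I \<subseteq> {1..<r}" "V \<noteq> {}"
  shows "eigenvalue (adjacency_matrix (with_proj (color_graph V c I)))
    (smallest_eigenvalue (with_proj (color_graph V c I)))"
proof -
  let ?A = "adjacency_matrix (with_proj (color_graph V c I))"
  have "eigenvalue ?A (\<Sum>t \<in> I. real (k t))"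
  proof (rule eigenvalue_of_eigenfunction[of "\<lambda>_. 1"])
    fix u assume "u \<in> V"
    have "adj t (\<lambda>_. 1) u = k t" if "t \<in> I" for t
      using card_color_neighbours[of t u] \<open>u \<in> V\<close> assms(1) that finite_vertices
      by (auto simp: adj_def simp flip: sum.inter_filter)
    thus "(\<Sum>t \<in> I. adj t (\<lambda>_. 1) u) = (\<Sum>t \<in> I. real (k t)) * 1" by simp
  qed (use assms in auto)
  hence "Min (spectrum ?A) \<in> spectrum ?A"
    using card_finite_spectrum(1)[OF adjacency_matrix_carrier] by (intro Min_in) (auto simp: spectrum_def)
  thus ?thesis by (simp add: spectrum_def smallest_eigenvalue_def)
qed

text \<open>The Perron eigenvalue is split off the characteristic polynomial first, so that no
  diagonalisation is needed to see that the remaining roots belong to zero-sum eigenvectors.\<close>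

lemma zero_weight_spectral_radius_le:
  assumes "I \<subseteq> {1..<r}" "b < (\<Sum>t \<in> I. real (k t))"
    and bound: "\<And>(f :: 'a \<Rightarrow> real) x. \<lbrakk>sum f V = 0; \<exists>u \<in> V. f u \<noteq> 0;
      \<And>u. u \<in> V \<Longrightarrow> (\<Sum>t \<in> I. adj t f u) = x * f u\<rbrakk> \<Longrightarrow> \<bar>x\<bar> \<le> b"
    and ex: "\<exists>(f :: 'a \<Rightarrow> real) x. sum f V = 0 \<and> (\<exists>u \<in> V. f u \<noteq> 0) \<and>
      (\<forall>u \<in> V. (\<Sum>t \<in> I. adj t f u) = x * f u)"
  shows "zero_weight_spectral_radius (with_proj (color_graph V c I)) \<le> b"
proof -
  define A where "A = adjacency_matrix (with_proj (color_graph V c I))"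
  define K where "K = (\<Sum>t \<in> I. real (k t))"
  obtain f0 :: "'a \<Rightarrow> real" and x0 where f0: "sum f0 V = 0" "\<exists>u \<in> V. f0 u \<noteq> 0"
    "\<And>u. u \<in> V \<Longrightarrow> (\<Sum>t \<in> I. adj t f0 u) = x0 * f0 u" using ex by blast
  have "card V > 0" using f0(2) finite_vertices by (auto simp: card_gt_0_iff)
  then obtain m where m: "card V = Suc m" using gr0_implies_Suc by blast
  have A: "A \<in> carrier_mat (Suc m) (Suc m)"
    using adjacency_matrix_carrier[of I] by (simp add: A_def m)
  have row: "(\<Sum>j = 0..<Suc m. A $$ (i, j)) = K" if "i < Suc m" for i
    using adjacency_matrix_line_sum[of i I] that assms(1) unfolding A_def K_def m by blast
  have col: "(\<Sum>i = 0..<Suc m. A $$ (i, j)) = K" if "j < Suc m" for j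
  proof -
    have "(\<Sum>i = 0..<Suc m. A $$ (i, j)) = (\<Sum>i = 0..<Suc m. A $$ (j, i))"
      by (rule sum.cong) (use adjacency_matrix_symmetric[of _ j I] that m in \<open>auto simp: A_def\<close>)
    thus ?thesis using row[OF that] by simp
  qed
  obtain q where q: "char_poly A = [:- K, 1:] * q"
    and q_root: "\<And>x. poly q x = 0 \<Longrightarrow> \<exists>v \<in> carrier_vec (Suc m).
           v \<noteq> 0\<^sub>v (Suc m) \<and> (\<Sum>i = 0..<Suc m. v $ i) = 0 \<and> A *\<^sub>v v = x \<cdot>\<^sub>v v"
    using char_poly_deflate_constant_line_sums[OF A row col] by blast
  have "q \<noteq> 0" using q degree_monic_char_poly[OF A] by auto
  define R where "R = proots q"
  have set_R: "set_mset R = {x. poly q x = 0}" using \<open>q \<noteq> 0\<close> by (simp add: R_def)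
  have R_le: "\<bar>x\<bar> \<le> b" if x: "x \<in># R" for x
  proof -
    obtain v where v: "v \<in> carrier_vec (card V)" "v \<noteq> 0\<^sub>v (card V)" "(\<Sum>i = 0..<card V. v $ i) = 0"
      "A *\<^sub>v v = x \<cdot>\<^sub>v v"
      using q_root[of x] x set_R unfolding m by blast
    obtain f :: "'a \<Rightarrow> real" where "sum f V = 0" "\<exists>u \<in> V. f u \<noteq> 0"
      "\<And>u. u \<in> V \<Longrightarrow> (\<Sum>t \<in> I. adj t f u) = x * f u"
      using eigenfunction_of_eigenvector[OF v(1,2) assms(1) v(4)[unfolded A_def]] v(3) by metis
    thus ?thesis by (rule bound)
  qed
  have "proots (char_poly A) = add_mset K R"
    unfolding q R_def using \<open>q \<noteq> 0\<close> by (subst proots_mult) auto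
  \<comment> \<open>All of \<open>R\<close> is at most \<open>b\<close>, which is below
    \<open>K\<close>; so \<open>K\<close> comes last in ascending order, and \<open>tl\<close> of
    the reversed list removes exactly this copy.\<close>
  also have "sorted_list_of_multiset \<dots> = sorted_list_of_multiset R @ [K]"
  proof -
    have "sorted (sorted_list_of_multiset R @ [K])"
      using R_le assms(2) by (fastforce simp: sorted_append K_def)
    moreover have "add_mset K R = mset (sorted_list_of_multiset R @ [K])" by simp
    ultimately show ?thesis by (metis sorted_list_of_multiset_mset sorted_sort_id)
  qed
  finally have tl: "set (tl (adjacency_eigenvalues (with_proj (color_graph V c I)))) = set_mset R"
    by (simp add: adjacency_eigenvalues_def flip: A_def)
  \<comment> \<open>The given eigenvalue \<open>x0\<close> differs from \<open>K\<close>, hence is a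
    root of \<open>q\<close>; this makes \<open>R\<close> nonempty, as \<open>Max_le_iff\<close>
    requires.\<close>
  have "poly (char_poly A) x0 = 0"
    using eigenvalue_of_eigenfunction[OF f0(2,3) assms(1)] eigenvalue_root_char_poly[OF A]
    by (simp add: A_def)
  moreover have "x0 \<noteq> K" using bound[OF f0] assms(2) by (auto simp: K_def)
  ultimately have "x0 \<in># R" using q set_R by simp
  thus ?thesis unfolding zero_weight_spectral_radius_def tl using R_le by (subst Max_le_iff) auto
qed

end

section \<open>Combination of the two bounds for the union of X_1 and X_2\<close>

theorem theorem5p4:
  fixes V :: "'a set" and c :: "'a \<Rightarrow> 'a \<Rightarrow> nat" and \<epsilon> :: real
  assumes "association_scheme V c 4"
    and "scheme_diameter_2 V c 4"
    and "card V \<ge> 29"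
    and "constituent_degree V c 1 \<le> constituent_degree V c 2"
    and "constituent_degree V c 2 \<le> constituent_degree V c 3"
    and "\<epsilon> < 1 / 10 ^ 11"
    and "real (constituent_degree V c 2) \<le> \<epsilon> * real (constituent_degree V c 3) / 2"
    and "real (constituent_degree V c 2) \<le> 101 / 100 * real (constituent_degree V c 1)"
    and "strongly_regular (with_proj (constituent V c 2))"
    and "smallest_eigenvalue (with_proj (constituent V c 2)) = -2"
  shows "real (max_common_neighbours (with_proj (color_graph V c {1, 2})))
      + zero_weight_spectral_radius (with_proj (color_graph V c {1, 2}))
    \<le> 99 / 100 * real (constituent_degree V c 1 + constituent_degree V c 2)"
proof -
  interpret rank4_scheme V c using assms(1) by (simp add: rank4_scheme_def)
  have "graph_diameter (with_proj (constituent V c i)) \<le> 2" if "i \<in> {1, 2}" for i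
    using assms(2) that unfolding scheme_diameter_2_def by auto
  hence pos: "p 3 1 1 > 0" "p 3 2 2 > 0"
    using intersection_number_pos_if_diameter_le_2[of 1 3] intersection_number_pos_if_diameter_le_2[of 2 3]
    by simp_all
  have "V \<noteq> {}" using assms(3) by auto
  have k3: "100000 * real (k 2) \<le> real (k 3)"
  proof -
    have "\<epsilon> * real (k 3) \<le> 1 / 10 ^ 11 * real (k 3)" using assms(6) by (intro mult_right_mono) auto
    thus ?thesis using assms(7) by simp
  qed
  \<comment> \<open>Pairs of color 1 and of color 3 are both distinct and non-adjacent in X_2, so
    they share the same parameter \<open>m\<close>.\<close>
  have mu: "p 1 2 2 = p 3 2 2"
  proof -
    obtain m where m: "\<And>u v. \<lbrakk>u \<in> V; v \<in> V; u \<noteq> v; c u v \<noteq> 2\<rbrakk> \<Longrightarrow>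
        card (common_neighbours (with_proj (constituent V c 2)) u v) = m"
      using assms(9) unfolding strongly_regular_def by (auto simp: pverts_color_graph parcs_color_graph)
    have "p t 2 2 = m" if "t \<in> {1, 3}" for t
    proof -
      have "t < 4" using that by auto
      then obtain u v where uv: "u \<in> V" "v \<in> V" "c u v = t" using color_occurs[of t] by blast
      hence "u \<noteq> v" using diagonal[of u v] that by auto
      with m[OF uv(1,2)] uv that card_common_neighbours_color_graph[OF uv(1,2), of "{2}"]
      show ?thesis by auto
    qed
    thus ?thesis by simp
  qed
  have I2: "{2 :: nat} \<subseteq> {1..<4}" by simp
  have "eigenvalue (adjacency_matrix (with_proj (constituent V c 2))) (- 2)"
    using eigenvalue_smallest_eigenvalue[of "{2}"] \<open>V \<noteq> {}\<close> assms(10) by simp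
  then obtain v where v: "v \<in> carrier_vec (card V)" "v \<noteq> 0\<^sub>v (card V)"
    "adjacency_matrix (with_proj (constituent V c 2)) *\<^sub>v v = (- 2) \<cdot>\<^sub>v v"
    using adjacency_matrix_carrier[of "{2}"] by (auto simp: eigenvalue_def eigenvector_def)
  obtain f :: "'a \<Rightarrow> real" where f: "\<exists>u \<in> V. f u \<noteq> 0"
    "\<And>u. u \<in> V \<Longrightarrow> (\<Sum>t \<in> {2}. adj t f u) = - 2 * f u"
    using eigenfunction_of_eigenvector[OF v(1,2) I2 v(3)] by blast
  have f2: "adj 2 f u = - 2 * f u" if "u \<in> V" for u using f(2)[OF that] by simp
  \<comment> \<open>Summing the eigenvalue equation over \<open>V\<close> scales the total by
    \<open>k 2\<close> on one side and by -2 on the other, so the total is zero.\<close>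
  have "real (k 2) * sum f V = - 2 * sum f V"
    using sum_adj_vertices[of 2 f] f2 by (simp add: sum_negf flip: sum_distrib_left)
  hence "(real (k 2) + 2) * sum f V = 0" by (simp add: distrib_right)
  hence "sum f V = 0" using of_nat_0_le_iff[of "k 2", where ?'a = real] by auto
  then interpret small_rank4_srg_scheme V c
    using f(1) f2 mu pos k3 assms(4) by unfold_locales auto
  \<comment> \<open>The maximum is attained: a pair of color 1 shows that there are distinct
    vertices, and there are finitely many pairs.\<close>
  have "max_common_neighbours (with_proj (color_graph V c {1, 2})) \<in>
    (\<lambda>(u, v). card (common_neighbours (with_proj (color_graph V c {1, 2})) u v)) ` {(u, v) \<in> V \<times> V. u \<noteq> v}"
  proof -
    let ?S = "{(u, v) \<in> V \<times> V. u \<noteq> v}"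
    obtain u v where "u \<in> V" "v \<in> V" "c u v = 1" using color_occurs[of 1] by auto
    hence "(u, v) \<in> ?S" using diagonal[of u v] by auto
    moreover have "finite ?S" using finite_vertices by (auto intro: finite_subset[of _ "V \<times> V"])
    moreover have "max_common_neighbours (with_proj (color_graph V c {1, 2})) =
      Max ((\<lambda>(u, v). card (common_neighbours (with_proj (color_graph V c {1, 2})) u v)) ` ?S)"
      unfolding max_common_neighbours_def
      by (rule arg_cong[of _ _ Max]) (auto simp: pverts_color_graph image_def)
    ultimately show ?thesis by (metis (no_types, lifting) Max_in empty_iff finite_imageI image_is_empty)
  qed
  then obtain u v where uv: "u \<in> V" "v \<in> V" "u \<noteq> v" and
    q: "max_common_neighbours (with_proj (color_graph V c {1, 2})) =
      card (common_neighbours (with_proj (color_graph V c {1, 2})) u v)" by auto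
  have t: "c u v \<in> {1, 2, 3}" using color_less[OF uv(1,2)] diagonal[OF uv(1,2)] uv(3) by auto
  have "p (c u v) 2 1 = p (c u v) 1 2" using intersection_number_commute[of 2 1 "c u v"] t by auto
  hence "max_common_neighbours (with_proj (color_graph V c {1, 2})) =
      p (c u v) 1 1 + 2 * p (c u v) 1 2 + p (c u v) 2 2"
    using q card_common_neighbours_color_graph[OF uv(1,2), of "{1, 2}"] by simp
  hence q_le: "real (max_common_neighbours (with_proj (color_graph V c {1, 2}))) \<le> 51 / 100 * real (k 2)"
    using common_neighbours_12_le[OF t] by simp
  have "zero_weight_spectral_radius (with_proj (color_graph V c {1, 2})) \<le> 61 / 100 * real (k 2)"
  proof (rule zero_weight_spectral_radius_le)
    show "61 / 100 * real (k 2) < (\<Sum>t \<in> {1, 2}. real (k t))" using k_2_pos by simp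
    show "\<bar>x\<bar> \<le> 61 / 100 * real (k 2)"
      if "sum g V = 0" "\<exists>u \<in> V. g u \<noteq> 0" "\<And>u. u \<in> V \<Longrightarrow> (\<Sum>t \<in> {1, 2}. adj t g u) = x * g u"
      for g :: "'a \<Rightarrow> real" and x
      by (rule sum_eigenvalue_bound[OF that(1,2)]) (use that(3) in auto)
    obtain g :: "'a \<Rightarrow> real" and x where "sum g V = 0" "\<exists>u \<in> V. g u \<noteq> 0"
      "\<And>u. u \<in> V \<Longrightarrow> adj 1 g u + adj 2 g u = x * g u" using sum_eigenvector_exists by blast
    thus "\<exists>(g :: 'a \<Rightarrow> real) x. sum g V = 0 \<and> (\<exists>u \<in> V. g u \<noteq> 0) \<and>
        (\<forall>u \<in> V. (\<Sum>t \<in> {1, 2}. adj t g u) = x * g u)"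
      by (intro exI[of _ g] exI[of _ x]) auto
  qed auto
  \<comment> \<open>The left side is at most \<open>112 / 100 * k 2\<close>, while
    \<open>k 1\<close> being at least \<open>100 / 101 * k 2\<close> makes the right side more than
    \<open>196 / 100 * k 2\<close>.\<close>
  with q_le assms(8) show ?thesis by simp
qed

end
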